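(* Let $f(t)\in\mathbb{Z}[t,t^{-1}]$ be a Laurent polynomial. Then the following are equivalent. (i) There exists a long virtual knot $K$ with $W_0(K;t)=f(t)$ and $sg_2(K)=0$. (ii) $f(1)=0$. The same equivalence holds with $W_0$ replaced by $W_1$.
   Context: Long virtual knots. A long virtual knot diagram is an oriented immersed line in $\mathbb{R}^2$ that coincides with the $x$-axis outside a $2$-disk (oriented from $-\infty$ to $\infty$), each of whose double points is either a real crossing (with over/under information) or a virtual crossing. A long virtual knot is an equivalence class of such diagrams under the generalized (real, virtual and mixed) Reidemeister moves performed inside a $2$-disk. Let $\Sigma_g$ be a connected oriented closed surface of genus $g$. A surface realization $(\Sigma_g,D)$ of a diagram $D$ is an oriented closed-curve diagram with a basepoint on $\Sigma_g$, having only real crossings, such that traversing it from the basepoint one meets the same real crossings, in the same order and with the same over/under information and signs, as when traversing $D$ from $-\infty$ to $\infty$. $2$-supporting genus. Let $\Sigma_{g,2}$ be a connected oriented compact surface of genus $g$ with two boundary components. A surface realization $(\Sigma_{g,2},D)$ of $D$ is an oriented arc diagram on $\Sigma_{g,2}$ with only real crossings, with the same sequence of crossings, over/under information and signs as $D$, whose two boundary points lie on distinct boundary components of $\Sigma_{g,2}$. The $2$-supporting genus is $sg_2(K)=\min\{g\mid(\Sigma_{g,2},D)\text{ is a surface realization of (some diagram of) }K\}$. Writhe polynomials. Let $c_1,\dots,c_n$ be the real crossings of a diagram $D$ of $K$, with signs $\varepsilon_i\in\{\pm1\}$. Call $c_i$ of type $0$ if, traversing $D$ from $-\infty$, one passes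 $c_i$ first over and then under; otherwise of type $1$. Put $I_a(D)=\{i\mid c_i\text{ is of type }a\}$ for $a\in\{0,1\}$. On a surface realization $(\Sigma_g,D)$, orientation-respecting smoothing at $c_i$ yields two cycles; $\alpha_i$ is the one not containing the basepoint and $\beta_i$ the one containing it. A dot denotes the intersection number of cycles on $\Sigma_g$ (with a fixed standard sign convention). The $a$-writhe polynomial $W_a(K;t)=\sum_{i\in I_a(D)}\varepsilon_i(t^{\alpha_i\cdot\beta_i}-1)$ is an invariant of $K$. *)

theory Defs
  imports Complex_Main "HOL-Library.Poly_Mapping" "HOL-Combinatorics.Orbits"
begin

section \<open>Curves with crossings, as words\<close>

text \<open>
  A generic oriented curve is recorded by the sequence of its passages through double points.
  \<open>Over c s\<close> and \<open>Under c s\<close> are the two passages through a real crossing \<open>c\<close>, which is positive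
  iff \<open>s\<close>.  \<open>Virt c b\<close> and \<open>Virt c (\<not> b)\<close> are the two passages through a virtual crossing.
\<close>

datatype passage =
    is_over: Over (label: nat) (flag: bool)
  | is_under: Under (label: nat) (flag: bool)
  | is_virt: Virt (label: nat) (flag: bool)

fun partner :: "passage \<Rightarrow> passage" where
  "partner (Over c s) = Under c s"
| "partner (Under c s) = Over c s"
| "partner (Virt c b) = Virt c (\<not> b)"

text \<open>
  \<open>rtl x\<close>: during the passage \<open>x\<close> the other strand crosses the current one from right to left,
  i.e. (current direction, other direction) is a positive frame.  At a positive real crossing
  (over direction, under direction) is a positive frame.  At virtual crossings \<open>rtl\<close> is the flag.
\<close>

fun rtl :: "passage \<Rightarrow> bool" where
  "rtl (Over c s) = s"
| "rtl (Under c s) = (\<not> s)"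
| "rtl (Virt c b) = b"

definition crossing_word :: "passage list \<Rightarrow> bool" where
  "crossing_word w \<longleftrightarrow> distinct w \<and> (\<forall>x\<in>set w. partner x \<in> set w) \<and>
     (\<forall>x\<in>set w. \<forall>y\<in>set w. label x = label y \<longrightarrow> y = x \<or> y = partner x)"

definition real_part :: "passage list \<Rightarrow> passage list" where
  "real_part w = filter (\<lambda>x. \<not> is_virt x) w"


section \<open>Closed oriented surfaces and diagrams on them\<close>

text \<open>
  A connected closed oriented surface is given by a cell decomposition, encoded as a rotation
  system.  The dart \<open>(e, True)\<close> is the edge \<open>e\<close> leaving its tail, \<open>(e, False)\<close> is the same edge
  leaving its head; \<open>rot\<close> sends a dart to the counterclockwise next dart at the same vertex.
  Vertices are the orbits of \<open>rot\<close>, and faces (2-cells) are the orbits of \<open>rot \<circ> flip\<close>, which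
  follows the boundary of a face lying on the right.
\<close>

type_synonym dart = "nat \<times> bool"

definition flip :: "dart \<Rightarrow> dart" where
  "flip d = (fst d, \<not> snd d)"

record surface =
  edges :: "nat set"
  rot :: "dart \<Rightarrow> dart"

definition darts :: "surface \<Rightarrow> dart set" where
  "darts S = edges S \<times> UNIV"

definition closed_surface :: "surface \<Rightarrow> bool" where
  "closed_surface S \<longleftrightarrow> finite (edges S) \<and> edges S \<noteq> {} \<and> rot S permutes darts S \<and>
     (\<forall>d\<in>darts S. \<forall>d'\<in>darts S. (\<lambda>x y. y = rot S x \<or> y = flip x)\<^sup>*\<^sup>* d d')"

definition vertex :: "surface \<Rightarrow> dart \<Rightarrow> dart set" where
  "vertex S d = orbit (rot S) d"

definition euler_char :: "surface \<Rightarrow> int" where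
  "euler_char S = int (card (vertex S ` darts S)) - int (card (edges S))
     + int (card (orbit (rot S \<circ> flip) ` darts S))"

definition surface_of_genus :: "nat \<Rightarrow> surface \<Rightarrow> bool" where
  "surface_of_genus g S \<longleftrightarrow> closed_surface S \<and> euler_char S = 2 - 2 * int g"

text \<open>\<open>a, b, c, d\<close> are distinct darts at one vertex, in this counterclockwise cyclic order.\<close>

definition ccw :: "surface \<Rightarrow> dart \<Rightarrow> dart \<Rightarrow> dart \<Rightarrow> dart \<Rightarrow> bool" where
  "ccw S a b c d \<longleftrightarrow> (\<exists>i j k. 0 < i \<and> i < j \<and> j < k \<and> k < card (vertex S a) \<and>
     b = (rot S ^^ i) a \<and> c = (rot S ^^ j) a \<and> d = (rot S ^^ k) a)"

text \<open>
  \<open>diagram_on S ds w\<close>: the walk \<open>ds\<close> along edges of \<open>S\<close> is a generic curve whose sequence of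
  crossings is \<open>w\<close>.  The \<open>k\<close>-th passage takes place between \<open>ds ! k\<close> and \<open>ds ! Suc k\<close>.  Edges of
  the cell decomposition that do not belong to the curve may end at any vertex, so the
  complement of the curve need not consist of disks.  The curve visits the vertices at which
  it starts and ends nowhere in between.
\<close>

definition start_vertex :: "surface \<Rightarrow> dart list \<Rightarrow> dart set" where
  "start_vertex S ds = vertex S (hd ds)"

definition end_vertex :: "surface \<Rightarrow> dart list \<Rightarrow> dart set" where
  "end_vertex S ds = vertex S (flip (last ds))"

definition diagram_on :: "surface \<Rightarrow> dart list \<Rightarrow> passage list \<Rightarrow> bool" where
  "diagram_on S ds w \<longleftrightarrow> length ds = Suc (length w) \<and> set ds \<subseteq> darts S \<and> distinct (map fst ds) \<and>
     (\<forall>k<length w. vertex S (flip (ds ! k)) = vertex S (ds ! Suc k)) \<and>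
     (\<forall>k<length w. vertex S (ds ! Suc k) \<noteq> start_vertex S ds \<and>
                   vertex S (ds ! Suc k) \<noteq> end_vertex S ds) \<and>
     (\<forall>k<length w. \<forall>l<length w.
        vertex S (ds ! Suc k) = vertex S (ds ! Suc l) \<longleftrightarrow> label (w ! k) = label (w ! l)) \<and>
     (\<forall>k<length w. \<forall>l<length w. w ! l = partner (w ! k) \<and> rtl (w ! k) \<longrightarrow>
        ccw S (ds ! Suc k) (ds ! Suc l) (flip (ds ! k)) (flip (ds ! l)))"

text \<open>A closed curve, with its basepoint at the start vertex.\<close>

definition closed_diagram_on :: "surface \<Rightarrow> dart list \<Rightarrow> passage list \<Rightarrow> bool" where
  "closed_diagram_on S ds w \<longleftrightarrow> diagram_on S ds w \<and> start_vertex S ds = end_vertex S ds"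


section \<open>Long virtual knots\<close>

text \<open>
  The plane is the sphere without the start vertex, which is the point at infinity; the line
  comes from infinity and returns to it.  Since the line is connected, the crossing word
  determines the planar diagram up to isotopy.
\<close>

definition long_virtual_diagram :: "passage list \<Rightarrow> bool" where
  "long_virtual_diagram D \<longleftrightarrow> crossing_word D \<and>
     (\<exists>S ds. surface_of_genus 0 S \<and> closed_diagram_on S ds D)"

fun relabel :: "(nat \<Rightarrow> nat) \<Rightarrow> passage \<Rightarrow> passage" where
  "relabel h (Over c s) = Over (h c) s"
| "relabel h (Under c s) = Under (h c) s"
| "relabel h (Virt c b) = Virt (h c) b"

text \<open>
  Three strand segments, each a pair of consecutive passages in the order of travel, that cross
  pairwise and bound a triangular face.  At the passage \<open>x\<close>, the side of the triangle on the other
  strand leaves the crossing on the left of the current strand iff either the other strand goes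
  to the left and this side is its outgoing edge (\<open>partner x\<close> is a first passage), or it goes to
  the right and this side is its incoming edge.  On each strand both passages must agree.
\<close>

definition triangle :: "(passage \<times> passage) set \<Rightarrow> bool" where
  "triangle T \<longleftrightarrow> card T = 3 \<and>
     (\<forall>(x, y)\<in>T. x \<noteq> y \<and> partner x \<noteq> y \<and>
        {partner x, partner y} \<subseteq> fst ` T \<union> snd ` T \<and>
        (rtl x = (partner x \<in> fst ` T)) = (rtl y = (partner y \<in> fst ` T)))"

text \<open>
  Either three real crossings with a top and a bottom strand, or a strand with two virtual
  crossings that moves across a crossing of any kind.
\<close>

definition slidable :: "(passage \<times> passage) set \<Rightarrow> bool" where
  "slidable T \<longleftrightarrow>
     (\<exists>(x, y)\<in>T. is_over x \<and> is_over y) \<and> (\<exists>(x, y)\<in>T. is_under x \<and> is_under y) \<or>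
     (\<exists>(x, y)\<in>T. is_virt x \<and> is_virt y)"

text \<open>
  The real, virtual and mixed moves.  In \<open>two\<close> the condition on \<open>rtl\<close> says that the crossings
  \<open>x\<close> and \<open>y\<close> span a bigon.
\<close>

inductive reidemeister :: "passage list \<Rightarrow> passage list \<Rightarrow> bool" where
  one: "reidemeister (u @ v) (u @ [x, partner x] @ v)"
| two: "reidemeister (u @ v @ z) (u @ [x, y] @ v @ st @ z)"
    if "is_over x \<and> is_over y \<or> is_under x \<and> is_under y \<or> is_virt x \<and> is_virt y"
      and "rtl x \<noteq> rtl y"
      and "st = [partner x, partner y] \<or> st = [partner y, partner x]"
| three: "reidemeister (u @ [p, p'] @ v @ [q, q'] @ w @ [r, r'] @ z)
                       (u @ [p', p] @ v @ [q', q] @ w @ [r', r] @ z)"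
    if "triangle {(p, p'), (q, q'), (r, r')}" and "slidable {(p, p'), (q, q'), (r, r')}"
| rename: "reidemeister w (map (relabel h) w)" if "inj_on h (label ` set w)"

definition diagram_equiv :: "(passage list \<times> passage list) set" where
  "diagram_equiv = {(D, D'). long_virtual_diagram D \<and> long_virtual_diagram D' \<and>
     equivclp (\<lambda>A B. long_virtual_diagram A \<and> long_virtual_diagram B \<and> reidemeister A B) D D'}"

definition long_virtual_knots :: "passage list set set" where
  "long_virtual_knots = {D. long_virtual_diagram D} // diagram_equiv"


section \<open>The 2-supporting genus\<close>

text \<open>
  A compact surface of genus \<open>g\<close> with two boundary circles is given by a closed surface of genus
  \<open>g\<close> in which open disks around two vertices are removed.  Here these are the vertices at the
  ends of the arc; they are distinct, so the arc joins distinct boundary components.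
\<close>

definition two_realization :: "nat \<Rightarrow> surface \<Rightarrow> dart list \<Rightarrow> passage list \<Rightarrow> bool" where
  "two_realization g S ds D \<longleftrightarrow> surface_of_genus g S \<and> diagram_on S ds (real_part D) \<and>
     start_vertex S ds \<noteq> end_vertex S ds"

definition sg2 :: "passage list set \<Rightarrow> nat" where
  "sg2 K = (LEAST g. \<exists>D\<in>K. \<exists>S ds. two_realization g S ds D)"


section \<open>Writhe polynomials\<close>

text \<open>
  Laurent polynomials over the integers: finitely supported maps from exponents to
  coefficients, with convolution as multiplication.
\<close>

type_synonym laurent = "int \<Rightarrow>\<^sub>0 int"

definition laurent_eval :: "laurent \<Rightarrow> 'a::field \<Rightarrow> 'a" where
  "laurent_eval f t = (\<Sum>k\<in>Poly_Mapping.keys f. of_int (Poly_Mapping.lookup f k) * t powi k)"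

text \<open>The passages of a closed walk through vertices: pairs of incoming and outgoing dart.\<close>

definition turns :: "dart list \<Rightarrow> (dart \<times> dart) list" where
  "turns ds = zip (map flip ds) (rotate1 ds)"

text \<open>Local intersection sign at a vertex; it is 0 where two strands touch without crossing.\<close>

fun turn_sign :: "surface \<Rightarrow> dart \<times> dart \<Rightarrow> dart \<times> dart \<Rightarrow> int" where
  "turn_sign S (a_in, a_out) (b_in, b_out) =
     (if ccw S a_out b_out a_in b_in then 1 else if ccw S a_out b_in a_in b_out then - 1 else 0)"

text \<open>
  The intersection number of two closed walks without common edges.  A crossing counts 1 if the
  second walk crosses the first from right to left.
\<close>

definition intersection_number :: "surface \<Rightarrow> dart list \<Rightarrow> dart list \<Rightarrow> int" where
  "intersection_number S a b = (\<Sum>p\<leftarrow>turns a. \<Sum>q\<leftarrow>turns b. turn_sign S p q)"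

text \<open>
  The two cycles obtained by smoothing the crossing met at the passages \<open>k < l\<close>; the basepoint
  lies on \<open>beta\<close>.
\<close>

definition alpha :: "dart list \<Rightarrow> nat \<Rightarrow> nat \<Rightarrow> dart list" where
  "alpha ds k l = take (l - k) (drop (Suc k) ds)"

definition beta :: "dart list \<Rightarrow> nat \<Rightarrow> nat \<Rightarrow> dart list" where
  "beta ds k l = take (Suc k) ds @ drop (Suc l) ds"

text \<open>
  Real crossings of type \<open>a\<close>, each given by the positions of its two passages; the type is 0 if
  the first passage is over, and 1 otherwise.
\<close>

definition crossings_of_type :: "nat \<Rightarrow> passage list \<Rightarrow> (nat \<times> nat) set" where
  "crossings_of_type a w = {(k, l). k < l \<and> l < length w \<and> \<not> is_virt (w ! k) \<and>
     w ! l = partner (w ! k) \<and> a = (if is_over (w ! k) then 0 else 1)}"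

definition writhe_sum :: "nat \<Rightarrow> surface \<Rightarrow> dart list \<Rightarrow> passage list \<Rightarrow> laurent" where
  "writhe_sum a S ds w = (\<Sum>(k, l)\<in>crossings_of_type a w.
     (if flag (w ! k) then 1 else - 1) *
     (Poly_Mapping.single (intersection_number S (alpha ds k l) (beta ds k l)) 1 - 1))"

text \<open>
  The common value over all diagrams of the knot and all of their realizations on closed
  surfaces of arbitrary genus.
\<close>

definition writhe_poly :: "nat \<Rightarrow> passage list set \<Rightarrow> laurent" where
  "writhe_poly a K = (THE f. \<exists>D\<in>K. \<exists>S ds. closed_surface S \<and>
     closed_diagram_on S ds (real_part D) \<and> f = writhe_sum a S ds (real_part D))"

end

(*
  The intersection number alpha.beta of a smoothed crossing only depends on the word: it is the sum
  of the signs (other strand crossing from the right: +1, from the left: -1) over all passages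
  strictly between the two passages of the crossing, because crossings with both passages in
  between cancel.  Hence the writhe sum is the same for all realizations, and its invariance under
  the Reidemeister moves is a computation with words.  All its terms vanish at t = 1.

  Conversely, consider an arc in the annulus that runs inward, back outward parallel to itself, and
  then spirals m times around towards the inner boundary.  Its innermost crossings with the two
  radial strands have index m and opposite signs, and over/under information is free, so any single
  one of them can be made the only crossing of the given type.  Mirror images give -m, and arcs
  can be concatenated, so every polynomial vanishing at 1 arises.  Letting each arc finally run
  outward again across its own turns, with virtual crossings, turns it into a planar diagram.

  To see that all these diagrams live on the sphere, let the arc grow crossing by crossing: when its
  tip crosses an edge of the face it lies in, exactly one face is split in two, which keeps the
  Euler characteristic.
*)
theory Submission
  imports Defs
begin

section \<open>The writhe sum of a crossing word\<close>

text \<open>A surface is here nothing but a permutation of darts, so a diagram on the sphere has to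
  be obtained by counting orbits. A word determines such a permutation; vertices and edges are known
  in advance, and only the number of face cycles has to be controlled. This is why the spirals are
  grown one crossing at a time: when the tip crosses an older edge, the face permutation changes by
  one exchange of two images and the insertion of four darts, whose effect on the number of cycles
  is known exactly.

  Every word has to meet two demands at once. With its virtual crossings it must be planar with both
  ends on one face, so that the ends can be glued at the point at infinity; without them it must be
  planar with free ends, around which the two boundary circles are cut. Both demands are invariants
  of words, and a further spiral is grown from the tip of the word built so far, so no surfaces have
  to be glued together.\<close>

lemma partner_partner [simp]: "partner (partner x) = x"
  by (cases x) auto

lemma partner_neq [simp]: "partner x \<noteq> x" "x \<noteq> partner x"
  by (cases x; simp)+

lemma partner_eq_iff [simp]: "partner x = partner y \<longleftrightarrow> x = y"
  by (metis partner_partner)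

lemma partner_swap: "partner x = y \<longleftrightarrow> x = partner y"
  by (metis partner_partner)

lemma label_partner [simp]: "label (partner x) = label x"
  by (cases x) auto

lemma is_virt_partner [simp]: "is_virt (partner x) \<longleftrightarrow> is_virt x"
  by (cases x) auto

lemma rtl_partner [simp]: "rtl (partner x) \<longleftrightarrow> \<not> rtl x"
  by (cases x) auto

definition pos :: "'a list \<Rightarrow> 'a \<Rightarrow> nat" where
  "pos w x = length (takeWhile (\<lambda>y. y \<noteq> x) w)"

text \<open>The value 0 at virtual passages lets the sum be taken on words with virtual crossings,
  where the Reidemeister moves act.\<close>

definition rho :: "passage \<Rightarrow> int" where
  "rho x = (if is_virt x then 0 else if rtl x then 1 else - 1)"

text \<open>Prefix sums make the index of a crossing a difference of heights, so a move is
  understood once the change of every height is known.\<close>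

definition hgt :: "passage list \<Rightarrow> passage \<Rightarrow> int" where
  "hgt w x = sum_list (map rho (takeWhile (\<lambda>y. y \<noteq> x) w))"

text \<open>For a real crossing this is the intersection number of the two cycles of the smoothing,
  read off the word: every real passage strictly between the two passages of the crossing counts.\<close>

definition idx :: "passage list \<Rightarrow> passage \<Rightarrow> int" where
  "idx w x = hgt w (partner x) - hgt w x - rho x"

definition firsts :: "nat \<Rightarrow> passage list \<Rightarrow> passage set" where
  "firsts a w = {x\<in>set w. \<not> is_virt x \<and> a = (if is_over x then 0 else 1) \<and>
     pos w x < pos w (partner x)}"

definition crossing_term :: "passage list \<Rightarrow> passage \<Rightarrow> laurent" where
  "crossing_term w x = (if flag x then 1 else - 1) * (Poly_Mapping.single (idx w x) 1 - 1)"

definition word_writhe :: "nat \<Rightarrow> passage list \<Rightarrow> laurent" where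
  "word_writhe a w = (\<Sum>x\<in>firsts a w. crossing_term w x)"

lemma pos_append: "pos (u @ v) x = (if x \<in> set u then pos u x else length u + pos v x)"
  by (auto simp: pos_def takeWhile_append)

lemma pos_Nil [simp]: "pos [] x = 0"
  by (simp add: pos_def)

lemma pos_Cons [simp]: "pos (y # v) x = (if x = y then 0 else Suc (pos v x))"
  by (simp add: pos_def)

lemma pos_less: "x \<in> set w \<Longrightarrow> pos w x < length w"
  by (induction w) auto

lemma nth_pos: "x \<in> set w \<Longrightarrow> w ! pos w x = x"
  by (induction w) auto

lemma pos_nth: "distinct w \<Longrightarrow> i < length w \<Longrightarrow> pos w (w ! i) = i"
  by (metis nth_eq_iff_index_eq nth_mem nth_pos pos_less)

lemma pos_inj: "x \<in> set w \<Longrightarrow> pos w x = pos w y \<Longrightarrow> y \<in> set w \<Longrightarrow> x = y"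
  by (metis nth_pos)

lemma hgt_append: "hgt (u @ v) x = (if x \<in> set u then hgt u x else sum_list (map rho u) + hgt v x)"
  by (auto simp: hgt_def takeWhile_append)

lemma hgt_Nil [simp]: "hgt [] x = 0"
  by (simp add: hgt_def)

lemma hgt_Cons [simp]: "hgt (y # v) x = (if x = y then 0 else rho y + hgt v x)"
  by (simp add: hgt_def)

lemma rho_partner [simp]: "rho (partner x) = - rho x"
  by (auto simp: rho_def)

lemma crossing_word_distinct: "crossing_word w \<Longrightarrow> distinct w"
  and crossing_word_partner: "crossing_word w \<Longrightarrow> x \<in> set w \<Longrightarrow> partner x \<in> set w"
  and crossing_word_label: "crossing_word w \<Longrightarrow> x \<in> set w \<Longrightarrow> y \<in> set w \<Longrightarrow> label x = label y \<Longrightarrow>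
    y = x \<or> y = partner x"
  by (auto simp: crossing_word_def)

lemma finite_firsts [simp]: "finite (firsts a w)"
  by (simp add: firsts_def)

section \<open>Invariance under the Reidemeister moves\<close>

text \<open>The \<open>rho\<close> values of the inserted pair cancel, so no other index changes,
  and the new crossing has index 0, where its term vanishes.\<close>

lemma word_writhe_one:
  assumes "crossing_word (u @ [x, partner x] @ v)" "crossing_word (u @ v)"
  shows "word_writhe a (u @ [x, partner x] @ v) = word_writhe a (u @ v)"
proof -
  let ?w = "u @ v" and ?w' = "u @ [x, partner x] @ v"
  have d: "distinct ?w'" using assms(1) by (rule crossing_word_distinct)
  have p: "partner y \<in> set ?w" if "y \<in> set ?w" for y
    using assms(2) that by (rule crossing_word_partner)
  have h: "hgt ?w' y = hgt ?w y" if "y \<in> set ?w" for y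
    using d that by (auto simp: hgt_append)
  have o: "pos ?w' y < pos ?w' z \<longleftrightarrow> pos ?w y < pos ?w z" if "y \<in> set ?w" "z \<in> set ?w" for y z
    using d that pos_less[of y u] pos_less[of z u] by (auto simp: pos_append)
  have i: "idx ?w' y = idx ?w y" if "y \<in> set ?w" for y
    unfolding idx_def using h[OF that] h[OF p[OF that]] by simp
  have tm: "crossing_term ?w' y = crossing_term ?w y" if "y \<in> set ?w" for y
    by (simp only: crossing_term_def i[OF that])
  have sub: "firsts a ?w \<subseteq> firsts a ?w'"
    using o p by (auto simp: firsts_def)
  have diff: "firsts a ?w' - firsts a ?w \<subseteq> {x, partner x}"
    using o p by (auto simp: firsts_def)
  have np: "partner x \<notin> firsts a ?w'"
    using d by (auto simp: firsts_def pos_append)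
  have "idx ?w' x = 0"
    using d by (auto simp: idx_def hgt_append)
  then have z: "crossing_term ?w' y = 0" if "y \<in> firsts a ?w' - firsts a ?w" for y
    using that diff np by (auto simp: crossing_term_def)
  have "word_writhe a ?w' = (\<Sum>y\<in>firsts a ?w. crossing_term ?w' y)"
    unfolding word_writhe_def using sub z by (intro sum.mono_neutral_right) auto
  also have "\<dots> = word_writhe a ?w"
    unfolding word_writhe_def by (intro sum.cong refl tm) (auto simp: firsts_def)
  finally show ?thesis .
qed

text \<open>Each inserted pair has \<open>rho\<close> sum 0, so old indices persist. If the two new
  crossings are real, they have the same type and index but opposite signs, and their terms cancel;
  this holds for both orders of \<open>st\<close>.\<close>

lemma word_writhe_two:
  assumes w': "crossing_word (u @ [x, y] @ v @ st @ z)" and w: "crossing_word (u @ v @ z)"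
    and k: "is_over x \<and> is_over y \<or> is_under x \<and> is_under y \<or> is_virt x \<and> is_virt y"
    and r: "rtl x \<noteq> rtl y"
    and st: "st = [partner x, partner y] \<or> st = [partner y, partner x]"
  shows "word_writhe a (u @ [x, y] @ v @ st @ z) = word_writhe a (u @ v @ z)"
proof -
  let ?w = "u @ v @ z" and ?w' = "u @ [x, y] @ v @ st @ z"
  have d: "distinct ?w'" using w' by (rule crossing_word_distinct)
  have sst: "set st = {partner x, partner y}" "length st = 2"
    using st by auto
  have rxy: "rho x + rho y = 0"
    using k r by (cases x; cases y; auto simp: rho_def)
  have kk: "is_virt y = is_virt x" "is_over y = is_over x"
    using k by (cases x; cases y; simp)+
  have rst: "sum_list (map rho st) = 0"
    using st rxy by auto
  have p: "partner t \<in> set ?w" if "t \<in> set ?w" for t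
    using w that by (rule crossing_word_partner)
  have new: "t \<notin> {x, y, partner x, partner y}" if "t \<in> set ?w" for t
    using d that st by auto
  have h: "hgt ?w' t = hgt ?w t" if "t \<in> set ?w" for t
    using d that new[OF that] rxy rst by (auto simp: hgt_append sst)
  have o: "pos ?w' t < pos ?w' s \<longleftrightarrow> pos ?w t < pos ?w s" if "t \<in> set ?w" "s \<in> set ?w" for t s
  proof -
    \<comment> \<open>Passages of \<open>v\<close> are preceded by two new passages, those of
      \<open>z\<close> by four.\<close>
    have shift: "pos ?w' t = pos ?w t + (if t \<in> set u then 0 else if t \<in> set v then 2 else 4)"
      if "t \<in> set ?w" for t
      using d new[OF that] by (auto simp: pos_append sst)
    have range: "if t \<in> set u then pos ?w t < length u else
        if t \<in> set v then length u \<le> pos ?w t \<and> pos ?w t < length u + length v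
        else length u + length v \<le> pos ?w t" for t
      using pos_less[of t u] pos_less[of t v] by (auto simp: pos_append)
    show ?thesis
      using range[of t] range[of s] unfolding shift[OF that(1)] shift[OF that(2)]
      by (auto split: if_splits)
  qed
  have i: "idx ?w' t = idx ?w t" if "t \<in> set ?w" for t
    unfolding idx_def using h[OF that] h[OF p[OF that]] by simp
  have tm: "crossing_term ?w' y = crossing_term ?w y" if "y \<in> set ?w" for y
    by (simp only: crossing_term_def i[OF that])
  have dxy: "x \<noteq> y" "x \<noteq> partner y" "x \<notin> set u" "y \<notin> set u" "x \<notin> set v" "y \<notin> set v"
      "partner x \<notin> set u" "partner y \<notin> set u" "partner x \<notin> set v" "partner y \<notin> set v"
    using d st by auto
  then have dxy': "y \<noteq> partner x" "y \<noteq> x" by auto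
  have f: "firsts a ?w' = firsts a ?w \<union> (if \<not> is_virt x \<and> a = (if is_over x then 0 else 1) then {x, y} else {})"
    (is "_ = _ \<union> ?E")
  proof (intro equalityI subsetI)
    fix t assume t: "t \<in> firsts a ?w'"
    show "t \<in> firsts a ?w \<union> ?E"
    proof (cases "t \<in> set ?w")
      case True
      then show ?thesis using t o p by (auto simp: firsts_def)
    next
      case False
      have "t \<noteq> partner x" "t \<noteq> partner y"
        using t dxy dxy' st by (auto simp: firsts_def pos_append)
      then have "t = x \<or> t = y"
        using False t sst by (auto simp: firsts_def)
      then show ?thesis
        using t kk by (auto simp: firsts_def)
    qed
  next
    fix t assume "t \<in> firsts a ?w \<union> ?E"
    then consider "t \<in> firsts a ?w" | "t \<in> ?E" by blast
    then show "t \<in> firsts a ?w'"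
    proof cases
      case 1
      then have "t \<in> set ?w" by (simp add: firsts_def)
      then show ?thesis using 1 o p by (auto simp: firsts_def)
    next
      case 2
      have "pos ?w' x < pos ?w' (partner x)" "pos ?w' y < pos ?w' (partner y)"
        using dxy dxy' by (auto simp: pos_append)
      then show ?thesis
        using 2 kk by (auto simp: firsts_def split: if_splits)
    qed
  qed
  have e: "(\<Sum>t\<in>?E. crossing_term ?w' t) = 0"
  proof (cases "is_virt x")
    case False
    have "idx ?w' x = idx ?w' y"
      using dxy dxy' st rxy by (auto simp: idx_def hgt_append)
    moreover have "flag x \<noteq> flag y"
      using k r False by (cases x; cases y) auto
    ultimately have "crossing_term ?w' x + crossing_term ?w' y = 0"
      by (auto simp: crossing_term_def)
    then show ?thesis using dxy by auto
  qed auto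
  have "word_writhe a ?w' = (\<Sum>t\<in>firsts a ?w. crossing_term ?w' t) + (\<Sum>t\<in>?E. crossing_term ?w' t)"
    unfolding word_writhe_def f
  proof (rule sum.union_disjoint)
    show "firsts a ?w \<inter> ?E = {}"
      using new[of x] new[of y] by (auto simp: firsts_def)
  qed auto
  also have "\<dots> = (\<Sum>t\<in>firsts a ?w. crossing_term ?w' t)"
    by (simp only: e add_0_right)
  also have "\<dots> = word_writhe a ?w"
    unfolding word_writhe_def by (intro sum.cong refl tm) (auto simp: firsts_def)
  finally show ?thesis .
qed

lemma hgt_swap:
  assumes "distinct (u @ [p, q] @ v)"
  shows "hgt (u @ [q, p] @ v) y =
    hgt (u @ [p, q] @ v) y + (if y = p then rho q else if y = q then - rho p else 0)"
  using assms by (auto simp: hgt_append)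

lemma pos_swap:
  assumes "distinct (u @ [p, q] @ v)" "{y, z} \<noteq> {p, q}"
  shows "pos (u @ [q, p] @ v) y < pos (u @ [q, p] @ v) z \<longleftrightarrow>
    pos (u @ [p, q] @ v) y < pos (u @ [p, q] @ v) z"
  using assms pos_less[of y u] pos_less[of z u] by (auto simp: pos_append)

text \<open>A swap changes only the heights of the two swapped passages, each by the
  \<open>rho\<close> of the other up to sign. The triangle condition makes both passages of every
  real crossing change by the same amount, so the indices stay.\<close>

lemma word_writhe_three:
  assumes cw: "crossing_word (u @ [p, p'] @ v @ [q, q'] @ w @ [r, r'] @ z)"
    and tri: "triangle {(p, p'), (q, q'), (r, r')}" and sl: "slidable {(p, p'), (q, q'), (r, r')}"
  shows "word_writhe a (u @ [p', p] @ v @ [q', q] @ w @ [r', r] @ z) =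
    word_writhe a (u @ [p, p'] @ v @ [q, q'] @ w @ [r, r'] @ z)"
proof -
  let ?w0 = "u @ [p, p'] @ v @ [q, q'] @ w @ [r, r'] @ z"
  let ?w3 = "(u @ [p', p] @ v @ [q', q] @ w) @ [r', r] @ z"
  have d0: "distinct ?w0" using cw by (rule crossing_word_distinct)
  have d1: "distinct ((u @ [p', p] @ v) @ [q, q'] @ w @ [r, r'] @ z)" using d0 by auto
  have d2: "distinct ((u @ [p', p] @ v @ [q', q] @ w) @ [r, r'] @ z)" using d0 by auto
  define \<delta> where "\<delta> y = (if y = p then rho p' else if y = p' then - rho p else 0)
     + (if y = q then rho q' else if y = q' then - rho q else 0)
     + (if y = r then rho r' else if y = r' then - rho r else 0)" for y
  have h: "hgt ?w3 y = hgt ?w0 y + \<delta> y" for y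
    using hgt_swap[OF d0, of y] hgt_swap[OF d1, of y] hgt_swap[OF d2, of y]
    by (simp add: \<delta>_def)
  let ?T = "{(p, p'), (q, q'), (r, r')}"
  have side: "partner x \<noteq> y" "partner x \<in> {p, q, r} \<union> {p', q', r'}" "partner y \<in> {p, q, r} \<union> {p', q', r'}"
      "(rtl x = (partner x \<in> {p, q, r})) = (rtl y = (partner y \<in> {p, q, r}))"
    if "(x, y) \<in> ?T" for x y
  proof -
    have T: "fst ` ?T = {p, q, r}" "snd ` ?T = {p', q', r'}" by auto
    have "\<forall>(x, y)\<in>?T. x \<noteq> y \<and> partner x \<noteq> y \<and> {partner x, partner y} \<subseteq> {p, q, r} \<union> {p', q', r'} \<and>
        (rtl x = (partner x \<in> {p, q, r})) = (rtl y = (partner y \<in> {p, q, r}))"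
      using tri unfolding triangle_def T by (rule conjunct2)
    from bspec[OF this that] show "partner x \<noteq> y" "partner x \<in> {p, q, r} \<union> {p', q', r'}" "partner y \<in> {p, q, r} \<union> {p', q', r'}"
      "(rtl x = (partner x \<in> {p, q, r})) = (rtl y = (partner y \<in> {p, q, r}))"
      unfolding prod.case by blast+
  qed
  note sp = side[of p p'] and sq = side[of q q'] and sr = side[of r r']
  have tp: "partner p \<noteq> p'" "partner q \<noteq> q'" "partner r \<noteq> r'"
    using sp(1) sq(1) sr(1) by simp_all
  have ts: "partner p \<in> {p, q, r} \<union> {p', q', r'}" "partner p' \<in> {p, q, r} \<union> {p', q', r'}"
      "partner q \<in> {p, q, r} \<union> {p', q', r'}" "partner q' \<in> {p, q, r} \<union> {p', q', r'}"
      "partner r \<in> {p, q, r} \<union> {p', q', r'}" "partner r' \<in> {p, q, r} \<union> {p', q', r'}"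
    by (rule sp(2) sp(3) sq(2) sq(3) sr(2) sr(3), simp)+
  have tr: "(rtl p = (partner p \<in> {p, q, r})) = (rtl p' = (partner p' \<in> {p, q, r}))"
      "(rtl q = (partner q \<in> {p, q, r})) = (rtl q' = (partner q' \<in> {p, q, r}))"
      "(rtl r = (partner r \<in> {p, q, r})) = (rtl r' = (partner r' \<in> {p, q, r}))"
    by (rule sp(4) sq(4) sr(4), simp)+
  have ddist: "distinct [p, p', q, q', r, r']" using d0 by auto
  have ne: "p \<noteq> p'" "p \<noteq> q" "p \<noteq> q'" "p \<noteq> r" "p \<noteq> r'" "p' \<noteq> q" "p' \<noteq> q'" "p' \<noteq> r" "p' \<noteq> r'"
      "q \<noteq> q'" "q \<noteq> r" "q \<noteq> r'" "q' \<noteq> r" "q' \<noteq> r'" "r \<noteq> r'"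
    using ddist by simp_all
  \<comment> \<open>No strand swaps a passage with its own partner, so no crossing changes its
    type.\<close>
  have o: "pos ?w3 y < pos ?w3 (partner y) \<longleftrightarrow> pos ?w0 y < pos ?w0 (partner y)" for y
  proof -
    have ne: "{y, partner y} \<noteq> {p, p'}" "{y, partner y} \<noteq> {q, q'}" "{y, partner y} \<noteq> {r, r'}"
      using tp by (auto simp: doubleton_eq_iff)
    show ?thesis
      using pos_swap[OF d0 ne(1)] pos_swap[OF d1 ne(2)] pos_swap[OF d2 ne(3)] by simp
  qed
  \<comment> \<open>If one strand met the same other strand twice, the third would have to cross
    itself, which \<open>tp\<close> excludes. So any two strands cross once, in one of eight
    pairings.\<close>
  have match: "partner p = q \<and> partner p' = r \<and> partner q' = r' \<or>
      partner p = q \<and> partner p' = r' \<and> partner q' = r \<or>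
      partner p = q' \<and> partner p' = r \<and> partner q = r' \<or>
      partner p = q' \<and> partner p' = r' \<and> partner q = r \<or>
      partner p = r \<and> partner p' = q \<and> partner r' = q' \<or>
      partner p = r \<and> partner p' = q' \<and> partner r' = q \<or>
      partner p = r' \<and> partner p' = q \<and> partner r = q' \<or>
      partner p = r' \<and> partner p' = q' \<and> partner r = q"
    using ts tp ddist by simp (metis partner_partner partner_neq)
  \<comment> \<open>A top and a bottom strand together take part in all three crossings, which are
    therefore real.\<close>
  have virt: "\<not> is_virt p \<and> \<not> is_virt p' \<and> \<not> is_virt q \<and> \<not> is_virt q' \<and> \<not> is_virt r \<and> \<not> is_virt r' \<or>
      is_virt p \<and> is_virt p' \<or> is_virt q \<and> is_virt q' \<or> is_virt r \<and> is_virt r'"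
  proof (cases "(is_virt p \<and> is_virt p') \<or> (is_virt q \<and> is_virt q') \<or> (is_virt r \<and> is_virt r')")
    case False
    then have "(is_over p \<and> is_over p' \<or> is_over q \<and> is_over q' \<or> is_over r \<and> is_over r') \<and>
        (is_under p \<and> is_under p' \<or> is_under q \<and> is_under q' \<or> is_under r \<and> is_under r')"
      using sl by (auto simp: slidable_def)
    moreover have "is_over x \<Longrightarrow> \<not> is_virt x" "is_under x \<Longrightarrow> \<not> is_virt x" "is_over x \<Longrightarrow> \<not> is_under x" for x
      by (cases x; simp)+
    moreover have "is_virt (partner x) = is_virt x" for x by simp
    ultimately show ?thesis using match by metis
  qed blast
  have \<delta>six: "\<delta> p = rho p'" "\<delta> p' = - rho p" "\<delta> q = rho q'" "\<delta> q' = - rho q" "\<delta> r = rho r'" "\<delta> r' = - rho r"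
    using ddist by (auto simp: \<delta>_def)
  have six: "(\<not> is_virt p \<longrightarrow> \<delta> (partner p) = \<delta> p) \<and> (\<not> is_virt p' \<longrightarrow> \<delta> (partner p') = \<delta> p') \<and>
      (\<not> is_virt q \<longrightarrow> \<delta> (partner q) = \<delta> q) \<and> (\<not> is_virt q' \<longrightarrow> \<delta> (partner q') = \<delta> q') \<and>
      (\<not> is_virt r \<longrightarrow> \<delta> (partner r) = \<delta> r) \<and> (\<not> is_virt r' \<longrightarrow> \<delta> (partner r') = \<delta> r')"
    using match
    apply (elim disjE conjE)
    subgoal premises m
      using tr virt m[THEN arg_cong[where f = rtl], unfolded rtl_partner, symmetric]
        m[THEN arg_cong[where f = is_virt], unfolded is_virt_partner, symmetric]
      by (simp add: \<delta>six m m[unfolded partner_swap, symmetric] ne ne[symmetric]) (auto simp: rho_def)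
    subgoal premises m
      using tr virt m[THEN arg_cong[where f = rtl], unfolded rtl_partner, symmetric]
        m[THEN arg_cong[where f = is_virt], unfolded is_virt_partner, symmetric]
      by (simp add: \<delta>six m m[unfolded partner_swap, symmetric] ne ne[symmetric]) (auto simp: rho_def)
    subgoal premises m
      using tr virt m[THEN arg_cong[where f = rtl], unfolded rtl_partner, symmetric]
        m[THEN arg_cong[where f = is_virt], unfolded is_virt_partner, symmetric]
      by (simp add: \<delta>six m m[unfolded partner_swap, symmetric] ne ne[symmetric]) (auto simp: rho_def)
    subgoal premises m
      using tr virt m[THEN arg_cong[where f = rtl], unfolded rtl_partner, symmetric]
        m[THEN arg_cong[where f = is_virt], unfolded is_virt_partner, symmetric]
      by (simp add: \<delta>six m m[unfolded partner_swap, symmetric] ne ne[symmetric]) (auto simp: rho_def)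
    subgoal premises m
      using tr virt m[THEN arg_cong[where f = rtl], unfolded rtl_partner, symmetric]
        m[THEN arg_cong[where f = is_virt], unfolded is_virt_partner, symmetric]
      by (simp add: \<delta>six m m[unfolded partner_swap, symmetric] ne ne[symmetric]) (auto simp: rho_def)
    subgoal premises m
      using tr virt m[THEN arg_cong[where f = rtl], unfolded rtl_partner, symmetric]
        m[THEN arg_cong[where f = is_virt], unfolded is_virt_partner, symmetric]
      by (simp add: \<delta>six m m[unfolded partner_swap, symmetric] ne ne[symmetric]) (auto simp: rho_def)
    subgoal premises m
      using tr virt m[THEN arg_cong[where f = rtl], unfolded rtl_partner, symmetric]
        m[THEN arg_cong[where f = is_virt], unfolded is_virt_partner, symmetric]
      by (simp add: \<delta>six m m[unfolded partner_swap, symmetric] ne ne[symmetric]) (auto simp: rho_def)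
    subgoal premises m
      using tr virt m[THEN arg_cong[where f = rtl], unfolded rtl_partner, symmetric]
        m[THEN arg_cong[where f = is_virt], unfolded is_virt_partner, symmetric]
      by (simp add: \<delta>six m m[unfolded partner_swap, symmetric] ne ne[symmetric]) (auto simp: rho_def)
    done
  have \<delta>: "\<delta> (partner y) = \<delta> y" if "\<not> is_virt y" "y \<in> set ?w0" for y
  proof (cases "y \<in> {p, p', q, q', r, r'}")
    case True
    then show ?thesis using six that(1) by blast
  next
    case False
    then have "partner y \<notin> {p, p', q, q', r, r'}"
      using match by (auto simp: partner_swap)
    then show ?thesis using False by (simp add: \<delta>_def)
  qed
  have i: "idx ?w3 y = idx ?w0 y" if "\<not> is_virt y" "y \<in> set ?w0" for y
    using \<delta>[OF that] unfolding idx_def h by simp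
  have tm: "crossing_term ?w3 y = crossing_term ?w0 y" if "\<not> is_virt y" "y \<in> set ?w0" for y
    by (simp only: crossing_term_def i[OF that])
  have f: "firsts a ?w3 = firsts a ?w0"
    unfolding firsts_def using o by auto
  have "word_writhe a ?w3 = word_writhe a ?w0"
    unfolding word_writhe_def f by (intro sum.cong refl tm) (auto simp: firsts_def)
  then show ?thesis by simp
qed

lemma partner_relabel: "partner (relabel h x) = relabel h (partner x)"
  by (cases x) auto

lemma rho_relabel: "rho (relabel h x) = rho x"
  by (cases x) (auto simp: rho_def)

lemma inj_on_relabel:
  assumes "inj_on h (label ` A)"
  shows "inj_on (relabel h) A"
proof (rule inj_onI)
  fix x y assume "x \<in> A" "y \<in> A" "relabel h x = relabel h y"
  then show "x = y"
    using assms by (cases x; cases y) (auto simp: inj_on_def rev_image_eqI image_iff)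
qed

lemma takeWhile_map_inj:
  "inj_on f (insert x (set w)) \<Longrightarrow>
    takeWhile (\<lambda>y. y \<noteq> f x) (map f w) = map f (takeWhile (\<lambda>y. y \<noteq> x) w)"
  by (induction w) (auto simp: inj_on_def)

lemma word_writhe_relabel:
  assumes cw: "crossing_word w" and inj: "inj_on h (label ` set w)"
  shows "word_writhe a (map (relabel h) w) = word_writhe a w"
proof -
  let ?w = "map (relabel h) w"
  have ij: "inj_on (relabel h) (set w)" using inj by (rule inj_on_relabel)
  have tw: "takeWhile (\<lambda>y. y \<noteq> relabel h x) ?w = map (relabel h) (takeWhile (\<lambda>y. y \<noteq> x) w)"
    if "x \<in> set w" for x
    using ij that by (intro takeWhile_map_inj) (simp add: insert_absorb)
  have p: "pos ?w (relabel h x) = pos w x" and hg: "hgt ?w (relabel h x) = hgt w x"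
    if "x \<in> set w" for x
    using tw[OF that] by (simp_all add: pos_def hgt_def comp_def rho_relabel)
  have i: "idx ?w (relabel h x) = idx w x" if "x \<in> set w" for x
    using that crossing_word_partner[OF cw that] by (simp add: idx_def partner_relabel hg rho_relabel)
  have k: "is_virt (relabel h x) = is_virt x" "is_over (relabel h x) = is_over x" "flag (relabel h x) = flag x" for x
    by (cases x; simp)+
  have pw: "partner x \<in> set w" if "x \<in> set w" for x
    using cw that by (rule crossing_word_partner)
  have "relabel h x \<in> firsts a ?w \<longleftrightarrow> x \<in> firsts a w" if "x \<in> set w" for x
    using that by (simp add: firsts_def partner_relabel p[OF that] p[OF pw[OF that]] k)
  moreover have "firsts a ?w \<subseteq> relabel h ` set w" "firsts a w \<subseteq> set w"
    by (auto simp: firsts_def)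
  ultimately have f: "firsts a ?w = relabel h ` firsts a w"
    by blast
  have "inj_on (relabel h) (firsts a w)"
    using ij by (rule inj_on_subset) (auto simp: firsts_def)
  then have "word_writhe a ?w = (\<Sum>x\<in>firsts a w. crossing_term ?w (relabel h x))"
    unfolding word_writhe_def f by (simp add: sum.reindex)
  also have "\<dots> = word_writhe a w"
    unfolding word_writhe_def by (intro sum.cong) (auto simp: crossing_term_def i k firsts_def)
  finally show ?thesis .
qed

lemma word_writhe_reidemeister:
  assumes "reidemeister A B" "crossing_word A" "crossing_word B"
  shows "word_writhe a A = word_writhe a B"
  using assms
proof cases
  case (one u v x)
  then show ?thesis using assms word_writhe_one by metis
next
  case (two x y st u v z)
  then show ?thesis using assms word_writhe_two[of u x y v st z a] by simp
next
  case (three p p' q q' r r' u v w z)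
  then show ?thesis using assms word_writhe_three[of u p p' v q q' w r r' z a] by simp
next
  case (rename h)
  then show ?thesis using assms word_writhe_relabel by metis
qed

section \<open>Intersection numbers read off the word\<close>

lemma closed_surface_permutation:
  assumes "closed_surface S"
  shows "permutation (rot S)"
  using assms unfolding closed_surface_def permutation_permutes
  by (intro exI[of _ "darts S"]) (auto simp: darts_def)

lemma funpow_inj_card_orbit:
  assumes "permutation f"
  shows "inj_on (\<lambda>n. (f ^^ n) x) {..<card (orbit f x)}" and "(f ^^ card (orbit f x)) x = x"
proof -
  have x: "x \<in> orbit f x" using assms by (rule permutation_self_in_orbit)
  let ?N = "funpow_dist1 f x x"
  have inj: "inj_on (\<lambda>n. (f ^^ n) x) {0..<?N}" using x by (rule inj_on_funpow_dist1)
  then have N: "card (orbit f x) = ?N"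
    unfolding orbit_conv_funpow_dist1[OF x] by (subst card_image) auto
  show "inj_on (\<lambda>n. (f ^^ n) x) {..<card (orbit f x)}"
    using inj unfolding N by (simp add: atLeast0LessThan)
  show "(f ^^ card (orbit f x)) x = x"
    unfolding N using x by (rule funpow_dist1_prop)
qed

section \<open>Cyclic order of the darts at a vertex\<close>

context
  fixes S :: surface
  assumes perm: "permutation (rot S)"
begin

lemma vertex_funpow: "vertex S ((rot S ^^ i) a) = vertex S a"
  by (induction i) (auto simp: vertex_def permutation_orbit_step[OF perm])

lemma ccw_vertex:
  assumes "ccw S a b c d"
  shows "vertex S b = vertex S a" "vertex S c = vertex S a" "vertex S d = vertex S a"
  using assms by (auto simp: ccw_def vertex_funpow)

text \<open>Counting rotation steps from \<open>a\<close> turns the cyclic order into a linear one;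
  hence two incompatible cyclic orders with the same first dart contradict each other.\<close>

lemma ccw_order:
  fixes a
  defines "e \<equiv> \<lambda>y. LEAST n. (rot S ^^ n) a = y"
  assumes "ccw S a b c d"
  shows "0 < e b" "e b < e c" "e c < e d"
proof -
  obtain i j k where ijk: "0 < i" "i < j" "j < k" "k < card (vertex S a)"
      "b = (rot S ^^ i) a" "c = (rot S ^^ j) a" "d = (rot S ^^ k) a"
    using assms(2) by (auto simp: ccw_def)
  have "e ((rot S ^^ n) a) = n" if "n < card (vertex S a)" for n
    unfolding e_def
  proof (rule Least_equality)
    fix m assume m: "(rot S ^^ m) a = (rot S ^^ n) a"
    show "n \<le> m"
    proof (rule ccontr)
      assume "\<not> n \<le> m"
      then show False
        using funpow_inj_card_orbit(1)[OF perm, of a] m that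
        by (auto simp: inj_on_def vertex_def)
    qed
  qed simp
  then show "0 < e b" "e b < e c" "e c < e d" using ijk by auto
qed

text \<open>Brings cyclic orders to a common first dart, so that \<open>ccw_order\<close> can
  compare them.\<close>

lemma ccw_rotate:
  assumes "ccw S a b c d"
  shows "ccw S b c d a"
proof -
  let ?N = "card (vertex S a)"
  obtain i j k where ijk: "0 < i" "i < j" "j < k" "k < ?N"
      "b = (rot S ^^ i) a" "c = (rot S ^^ j) a" "d = (rot S ^^ k) a"
    using assms by (auto simp: ccw_def)
  have f: "(rot S ^^ m) a = (rot S ^^ (m - i)) b" if "i \<le> m" for m
    using that unfolding ijk(5) by (metis comp_apply funpow_add le_add_diff_inverse2)
  have "a = (rot S ^^ (?N - i)) b"
    using f[of ?N] ijk funpow_inj_card_orbit(2)[OF perm, of a] by (auto simp: vertex_def)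
  moreover have "c = (rot S ^^ (j - i)) b" "d = (rot S ^^ (k - i)) b"
    using f[of j] f[of k] ijk by auto
  moreover have "card (vertex S b) = ?N"
    using ccw_vertex(1)[OF assms] by simp
  ultimately show ?thesis
    unfolding ccw_def using ijk
    by (intro exI[of _ "j - i"] exI[of _ "k - i"] exI[of _ "?N - i"]) auto
qed

lemma turn_sign_vertex:
  assumes "vertex S (snd p) \<noteq> vertex S (snd q)"
  shows "turn_sign S p q = 0"
proof -
  obtain a b c d where pq: "p = (a, b)" "q = (c, d)" by (cases p; cases q)
  show ?thesis
    using assms ccw_vertex[of b d a c] ccw_vertex[of b c a d] unfolding pq by auto
qed

end

section \<open>Turns of the two cycles of a smoothing\<close>

lemma turns_eq:
  assumes "L \<noteq> []"
  shows "turns L = map (\<lambda>i. (flip (L ! i), L ! Suc i)) [0..<length L - 1] @ [(flip (last L), hd L)]"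
proof (rule nth_equalityI)
  show "length (turns L) = length (map (\<lambda>i. (flip (L ! i), L ! Suc i)) [0..<length L - 1] @ [(flip (last L), hd L)])"
    using assms by (simp add: turns_def)
  fix i assume "i < length (turns L)"
  then have i: "i < length L" by (simp add: turns_def)
  show "turns L ! i = (map (\<lambda>i. (flip (L ! i), L ! Suc i)) [0..<length L - 1] @ [(flip (last L), hd L)]) ! i"
  proof (cases "Suc i = length L")
    case True
    then have "i = length L - 1" by simp
    then show ?thesis
      using True i assms by (simp add: turns_def nth_rotate1 nth_append last_conv_nth hd_conv_nth)
  next
    case False
    then have "i < length L - 1" using i by linarith
    then show ?thesis using i by (simp add: turns_def nth_rotate1 nth_append)
  qed
qed

definition turn_at :: "dart list \<Rightarrow> nat \<Rightarrow> dart \<times> dart" where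
  "turn_at ds i = (flip (ds ! i), ds ! Suc i)"

text \<open>The last turn is the corner created by the smoothing, from the second arrival at the
  crossing to the first departure.\<close>

lemma turns_alpha:
  assumes "k < l" "l < length ds"
  shows "turns (alpha ds k l) = map (turn_at ds) [Suc k..<l] @ [(flip (ds ! l), ds ! Suc k)]"
proof -
  have n: "length (alpha ds k l) = l - k" "\<And>i. i < l - k \<Longrightarrow> alpha ds k l ! i = ds ! (Suc k + i)"
    using assms by (auto simp: alpha_def)
  have ne: "alpha ds k l \<noteq> []" using n(1) assms by auto
  have "last (alpha ds k l) = ds ! l" "hd (alpha ds k l) = ds ! Suc k"
    using assms ne by (auto simp: last_conv_nth hd_conv_nth n)
  moreover have "map (\<lambda>i. (flip (alpha ds k l ! i), alpha ds k l ! Suc i)) [0..<l - k - 1] =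
      map (turn_at ds) [Suc k..<l]"
    using assms by (intro nth_equalityI) (auto simp: n turn_at_def)
  ultimately show ?thesis
    unfolding turns_eq[OF ne] n(1) by simp
qed

text \<open>Besides the inherited turns there are the other corner of the smoothing and the turn
  through the basepoint.\<close>

lemma turns_beta:
  assumes "k < l" "Suc l < length ds"
  shows "turns (beta ds k l) = map (turn_at ds) [0..<k] @ [(flip (ds ! k), ds ! Suc l)] @
    map (turn_at ds) [Suc l..<length ds - 1] @ [(flip (last ds), hd ds)]"
proof -
  have e: "Suc (i + l - Suc k) = i + l - k" for i
    using assms(1) by linarith
  have n: "length (beta ds k l) = length ds - (l - k)"
      "\<And>i. i < length ds - (l - k) \<Longrightarrow> beta ds k l ! i = (if i \<le> k then ds ! i else ds ! (i + (l - k)))"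
    using assms by (auto simp: beta_def nth_append min_def algebra_simps e)
  have ne: "beta ds k l \<noteq> []" using n(1) assms by auto
  have "last (beta ds k l) = last ds" "hd (beta ds k l) = hd ds"
    using assms by (auto simp: beta_def hd_append)
  moreover have "map (\<lambda>i. (flip (beta ds k l ! i), beta ds k l ! Suc i)) [0..<length ds - (l - k) - 1] =
      map (turn_at ds) [0..<k] @ [(flip (ds ! k), ds ! Suc l)] @ map (turn_at ds) [Suc l..<length ds - 1]"
    using assms
    by (intro nth_equalityI) (auto simp: n turn_at_def nth_append algebra_simps less_Suc_eq e)
  ultimately show ?thesis
    unfolding turns_eq[OF ne] n(1) by simp
qed

lemma takeWhile_neq_nth:
  "distinct w \<Longrightarrow> m < length w \<Longrightarrow> takeWhile (\<lambda>y. y \<noteq> w ! m) w = take m w"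
  by (metis length_map nth_map pos_def pos_nth takeWhile_eq_take)

lemma hgt_nth:
  assumes "distinct w" "m < length w"
  shows "hgt w (w ! m) = (\<Sum>i<m. rho (w ! i))"
  unfolding hgt_def takeWhile_neq_nth[OF assms]
  using assms by (simp add: sum_list_sum_nth atLeast0LessThan min_def)

lemma idx_nth:
  assumes "distinct w" "k < l" "l < length w" "w ! l = partner (w ! k)"
  shows "idx w (w ! k) = (\<Sum>i\<in>{k<..<l}. rho (w ! i))"
proof -
  have "(\<Sum>i<l. rho (w ! i)) = (\<Sum>i<Suc k. rho (w ! i)) + (\<Sum>i\<in>{k<..<l}. rho (w ! i))"
    using assms(2) by (subst sum.union_disjoint[symmetric]) (auto intro!: sum.cong)
  then show ?thesis
    using hgt_nth[OF assms(1,3)] hgt_nth[of w k] assms by (simp add: idx_def)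
qed

lemma sum_list_map_upt: "(\<Sum>i\<leftarrow>[a..<b]. f i) = (\<Sum>i\<in>{a..<b}. f i :: int)"
  by (simp add: interv_sum_list_conv_sum_set_nat)

text \<open>The only turns that are not passages of \<open>w\<close> are the two corners and the
  basepoint, and these contribute nothing. What is left are the passages on \<open>alpha\<close>
  whose partner lies on \<open>beta\<close>.\<close>

lemma intersection_number_eq_idx:
  assumes S: "closed_surface S" and D: "closed_diagram_on S ds w" and cw: "crossing_word w"
    and real: "\<forall>x\<in>set w. \<not> is_virt x"
    and kl: "k < l" "l < length w" "w ! l = partner (w ! k)"
  shows "intersection_number S (alpha ds k l) (beta ds k l) = idx w (w ! k)"
proof -
  let ?n = "length w" and ?T = "turn_sign S" and ?P = "turn_at ds" and ?V = "vertex S"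
  note perm = closed_surface_permutation[OF S]
  note zero = turn_sign_vertex[OF perm]
  have dist: "distinct w" using cw by (rule crossing_word_distinct)
  have dg: "diagram_on S ds w" using D by (simp add: closed_diagram_on_def)
  then have len: "length ds = Suc ?n" by (simp add: diagram_on_def)
  have vbase: "?V (ds ! Suc i) \<noteq> ?V (hd ds)" if "i < ?n" for i
    using dg that by (auto simp: diagram_on_def start_vertex_def)
  have lab: "j = i \<or> w ! j = partner (w ! i)" if "?V (ds ! Suc i) = ?V (ds ! Suc j)" "i < ?n" "j < ?n" for i j
  proof -
    have "label (w ! i) = label (w ! j)" using dg that unfolding diagram_on_def by blast
    then have "w ! j = w ! i \<or> w ! j = partner (w ! i)"
      using crossing_word_label[OF cw] that by simp
    then show ?thesis using dist that by (auto simp: nth_eq_iff_index_eq)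
  qed
  have cc: "ccw S (ds ! Suc i) (ds ! Suc j) (flip (ds ! i)) (flip (ds ! j))"
    if "w ! j = partner (w ! i)" "rtl (w ! i)" "i < ?n" "j < ?n" for i j
    using dg that unfolding diagram_on_def by blast
  note order = ccw_order[OF perm] and rotate = ccw_rotate[OF perm]
  have cross: "?T (?P i) (?P j) = rho (w ! i)"
    if p: "w ! j = partner (w ! i)" and ij: "i < ?n" "j < ?n" for i j
  proof (cases "rtl (w ! i)")
    case True
    then show ?thesis using cc[OF p True ij] real ij by (auto simp: turn_at_def rho_def)
  next
    case False
    have "ccw S (ds ! Suc j) (ds ! Suc i) (flip (ds ! j)) (flip (ds ! i))"
      using cc[of i j] p False ij by simp
    from rotate[OF this] have c: "ccw S (ds ! Suc i) (flip (ds ! j)) (flip (ds ! i)) (ds ! Suc j)" .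
    have "\<not> ccw S (ds ! Suc i) (ds ! Suc j) (flip (ds ! i)) (flip (ds ! j))"
      using order[OF c] order(2,3)[of "ds ! Suc i" "ds ! Suc j" "flip (ds ! i)" "flip (ds ! j)"] by auto
    then show ?thesis using c False real ij by (auto simp: turn_at_def rho_def)
  qed
  have no_cross: "?T (?P i) (?P j) = 0"
    if "w ! j \<noteq> partner (w ! i)" "i \<noteq> j" "i < ?n" "j < ?n" for i j
    using zero[of "?P i" "?P j"] lab[of i j] that by (auto simp: turn_at_def simp del: turn_sign.simps)
  let ?a = "(flip (ds ! l), ds ! Suc k)" and ?b = "(flip (ds ! k), ds ! Suc l)" and ?o = "(flip (last ds), hd ds)"
  \<comment> \<open>The two darts of a corner are neighbours in the cyclic order of the four, so the
    cycles touch at the smoothed crossing and \<open>turn_sign\<close> takes its default value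
    0.\<close>
  have smooth: "?T ?a ?b = 0"
  proof (cases "rtl (w ! k)")
    case True
    have c: "ccw S (ds ! Suc k) (ds ! Suc l) (flip (ds ! k)) (flip (ds ! l))"
      using cc[of l k] kl True by simp
    have "\<not> ccw S (ds ! Suc k) (ds ! Suc l) (flip (ds ! l)) (flip (ds ! k))"
      using order[OF c] order(3)[of "ds ! Suc k" "ds ! Suc l" "flip (ds ! l)" "flip (ds ! k)"] by auto
    moreover have "\<not> ccw S (ds ! Suc k) (flip (ds ! k)) (flip (ds ! l)) (ds ! Suc l)"
      using order[OF c] order(2,3)[of "ds ! Suc k" "flip (ds ! k)" "flip (ds ! l)" "ds ! Suc l"] by auto
    ultimately show ?thesis by simp
  next
    case False
    have "ccw S (ds ! Suc l) (ds ! Suc k) (flip (ds ! l)) (flip (ds ! k))"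
      using cc[of k l] kl False by simp
    from rotate[OF this] have c: "ccw S (ds ! Suc k) (flip (ds ! l)) (flip (ds ! k)) (ds ! Suc l)" .
    have "\<not> ccw S (ds ! Suc k) (ds ! Suc l) (flip (ds ! l)) (flip (ds ! k))"
      using order[OF c] order(2,3)[of "ds ! Suc k" "ds ! Suc l" "flip (ds ! l)" "flip (ds ! k)"] by auto
    moreover have "\<not> ccw S (ds ! Suc k) (flip (ds ! k)) (flip (ds ! l)) (ds ! Suc l)"
      using order[OF c] order(2)[of "ds ! Suc k" "flip (ds ! k)" "flip (ds ! l)" "ds ! Suc l"] by auto
    ultimately show ?thesis by simp
  qed
  have a0: "?T ?a (?P j) = 0" if "j < ?n" "j \<noteq> k" "j \<noteq> l" for j
    using zero[of ?a "?P j"] lab[of k j] kl that nth_eq_iff_index_eq[OF dist, of j l]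
    by (auto simp: turn_at_def nth_eq_iff_index_eq simp del: turn_sign.simps)
  have b0: "?T (?P i) ?b = 0" if "i < ?n" "i \<noteq> k" "i \<noteq> l" for i
    using zero[of "?P i" ?b] lab[of l i] kl that nth_eq_iff_index_eq[OF dist, of i k]
    by (auto simp: turn_at_def nth_eq_iff_index_eq simp del: turn_sign.simps)
  have o0: "?T (?P i) ?o = 0" if "i < ?n" for i
    using zero[of "?P i" ?o] vbase[OF that] by (auto simp: turn_at_def simp del: turn_sign.simps)
  have ao: "?T ?a ?o = 0"
    using zero[of ?a ?o] vbase[of k] kl by (auto simp del: turn_sign.simps)
  \<comment> \<open>\<open>?I\<close> are the positions on \<open>alpha\<close>, \<open>?J\<close>
    those on \<open>beta\<close>; the involution \<open>?m\<close> exchanges the two passages of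
    each crossing.\<close>
  let ?I = "{k<..<l}" and ?J = "{0..<k} \<union> {Suc l..<?n}"
  let ?m = "\<lambda>i. pos w (partner (w ! i))"
  have I: "{Suc k..<l} = ?I" by auto
  have m: "?m i < ?n" "w ! ?m i = partner (w ! i)" "?m (?m i) = i" if "i < ?n" for i
    using crossing_word_partner[OF cw, of "w ! i"] that dist
    by (auto simp: pos_less nth_pos pos_nth)
  have uniq: "j = ?m i" if "w ! j = partner (w ! i)" "i < ?n" "j < ?n" for i j
    using that dist by (metis pos_nth)
  have inner: "(\<Sum>q\<leftarrow>turns (beta ds k l). ?T (?P i) q) = (if ?m i \<in> ?I then 0 else rho (w ! i))"
    if i: "i \<in> ?I" for i
  proof -
    have in': "i < ?n" "i \<noteq> k" "i \<noteq> l" using i kl by auto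
    have "(\<Sum>q\<leftarrow>turns (beta ds k l). ?T (?P i) q) =
        (\<Sum>j\<in>{0..<k}. ?T (?P i) (?P j)) + (\<Sum>j\<in>{Suc l..<?n}. ?T (?P i) (?P j))"
      using kl len by (simp add: turns_beta b0[OF in'] o0[OF in'(1)] sum_list_map_upt comp_def
          del: upt_Suc turn_sign.simps)
    also have "\<dots> = (\<Sum>j\<in>?J. ?T (?P i) (?P j))"
      using kl by (subst sum.union_disjoint) auto
    also have "\<dots> = (\<Sum>j\<in>?J. if j = ?m i then rho (w ! i) else 0)"
    proof (rule sum.cong[OF refl])
      fix j assume j: "j \<in> ?J"
      then have jn: "j < ?n" "i \<noteq> j" using kl i by auto
      show "?T (?P i) (?P j) = (if j = ?m i then rho (w ! i) else 0)"
      proof (cases "j = ?m i")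
        case True
        then have "w ! j = partner (w ! i)" using m(2)[OF in'(1)] by simp
        from cross[OF this in'(1) jn(1)] True show ?thesis by (simp del: turn_sign.simps)
      next
        case False
        then have "w ! j \<noteq> partner (w ! i)" using uniq[OF _ in'(1) jn(1)] by blast
        from no_cross[OF this jn(2) in'(1) jn(1)] False show ?thesis by (simp del: turn_sign.simps)
      qed
    qed
    also have "\<dots> = (if ?m i \<in> ?J then rho (w ! i) else 0)"
      by (subst sum.delta) auto
    also have "?m i \<in> ?J \<longleftrightarrow> ?m i \<notin> ?I"
    proof -
      have "?m i \<noteq> k"
      proof
        assume "?m i = k"
        then have "w ! i = w ! l" using m(2)[OF in'(1)] kl by (simp add: partner_swap)
        then show False using nth_eq_iff_index_eq[OF dist, of i l] in' kl by blast
      qed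
      moreover have "?m i \<noteq> l"
      proof
        assume "?m i = l"
        then have "w ! i = w ! k" using m(2)[OF in'(1)] kl by simp
        then show False using nth_eq_iff_index_eq[OF dist, of i k] in' kl by auto
      qed
      ultimately show ?thesis using m(1)[OF in'(1)] by auto
    qed
    finally show ?thesis by auto
  qed
  have last: "(\<Sum>q\<leftarrow>turns (beta ds k l). ?T ?a q) = 0"
  proof -
    have "(\<Sum>q\<leftarrow>turns (beta ds k l). ?T ?a q) =
        (\<Sum>j\<in>{0..<k}. ?T ?a (?P j)) + (\<Sum>j\<in>{Suc l..<?n}. ?T ?a (?P j))"
      using kl len by (simp add: turns_beta smooth ao sum_list_map_upt comp_def
          del: upt_Suc turn_sign.simps)
    also have "\<dots> = 0"
      using a0 kl by simp
    finally show ?thesis .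
  qed
  have "intersection_number S (alpha ds k l) (beta ds k l) =
      (\<Sum>i\<in>?I. \<Sum>q\<leftarrow>turns (beta ds k l). ?T (?P i) q)"
    unfolding intersection_number_def using kl len last
    by (simp add: turns_alpha sum_list_map_upt comp_def I del: upt_Suc turn_sign.simps)
  also have "\<dots> = (\<Sum>i\<in>?I. if ?m i \<in> ?I then 0 else rho (w ! i))"
    using inner by (rule sum.cong[OF refl])
  also have "\<dots> = (\<Sum>i\<in>?I. rho (w ! i)) - (\<Sum>i\<in>{i\<in>?I. ?m i \<in> ?I}. rho (w ! i))"
  proof -
    have "(\<Sum>i\<in>{i\<in>?I. ?m i \<in> ?I}. rho (w ! i)) = (\<Sum>i\<in>?I. if ?m i \<in> ?I then rho (w ! i) else 0)"
      by (rule sum.inter_filter) simp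
    then show ?thesis by (simp add: sum_subtractf[symmetric] if_distrib cong: sum.cong) (auto intro: sum.cong)
  qed
  also have "(\<Sum>i\<in>{i\<in>?I. ?m i \<in> ?I}. rho (w ! i)) = 0"
  proof -
    \<comment> \<open>Reindexing by \<open>?m\<close> negates every summand, so the sum equals its
      own negative.\<close>
    have "(\<Sum>i\<in>{i\<in>?I. ?m i \<in> ?I}. rho (w ! i)) = (\<Sum>i\<in>{i\<in>?I. ?m i \<in> ?I}. - rho (w ! i))"
      using m kl by (intro sum.reindex_bij_witness[of _ ?m ?m]) auto
    then show ?thesis by (simp add: sum_negf)
  qed
  finally show ?thesis using idx_nth[OF dist kl] by simp
qed

lemma writhe_sum_eq_word_writhe:
  assumes S: "closed_surface S" and D: "closed_diagram_on S ds w" and cw: "crossing_word w"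
    and real: "\<forall>x\<in>set w. \<not> is_virt x"
  shows "writhe_sum a S ds w = word_writhe a w"
  unfolding writhe_sum_def word_writhe_def
proof (rule sum.reindex_bij_witness)
  have dist: "distinct w" using cw by (rule crossing_word_distinct)
  let ?f = "\<lambda>x. (pos w x, pos w (partner x))"
  show "w ! fst kl \<in> firsts a w" "?f (w ! fst kl) = kl" if kl_in: "kl \<in> crossings_of_type a w" for kl
  proof -
    obtain k l where kl: "kl = (k, l)" "k < l" "l < length w" "\<not> is_virt (w ! k)"
        "w ! l = partner (w ! k)" "a = (if is_over (w ! k) then 0 else 1)"
      using kl_in unfolding crossings_of_type_def by blast
    have "pos w (w ! k) = k" "pos w (partner (w ! k)) = l"
      using kl dist by (simp_all add: pos_nth kl(5)[symmetric])
    then show "w ! fst kl \<in> firsts a w" "?f (w ! fst kl) = kl"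
      using kl by (simp_all add: firsts_def)
  qed
  show "?f x \<in> crossings_of_type a w" "w ! fst (?f x) = x" if "x \<in> firsts a w" for x
    using that crossing_word_partner[OF cw] by (auto simp: crossings_of_type_def firsts_def nth_pos pos_less)
  show "crossing_term w (w ! fst kl) = (case kl of (k, l) \<Rightarrow> (if flag (w ! k) then 1 else - 1) *
      (Poly_Mapping.single (intersection_number S (alpha ds k l) (beta ds k l)) 1 - 1))"
    if "kl \<in> crossings_of_type a w" for kl
    using that intersection_number_eq_idx[OF S D cw real]
    by (auto simp: crossing_term_def crossings_of_type_def)
qed

section \<open>Counting the cycles of a permutation\<close>

definition num_cycles :: "('a \<Rightarrow> 'a) \<Rightarrow> 'a set \<Rightarrow> nat" where
  "num_cycles f A = card (orbit f ` A)"

lemma fun_upd_swap_eq: "f(a := f b, b := f a) = f \<circ> transpose a b"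
  by (auto simp: fun_eq_iff transpose_def)

lemma permutes_fun_upd_swap:
  assumes "f permutes A" "a \<in> A" "b \<in> A"
  shows "f(a := f b, b := f a) permutes A"
  unfolding fun_upd_swap_eq using assms by (intro permutes_compose permutes_swap_id)

lemma orbit_permutes_eq:
  assumes "f permutes A" "finite A" "y \<in> orbit f x"
  shows "orbit f y = orbit f x"
  using assms orbit_cyclic_eq3[OF cyclic_on_orbit] by metis

lemma self_in_orbit_permutes:
  assumes "f permutes A" "finite A"
  shows "x \<in> orbit f x"
  using assms by (intro permutation_self_in_orbit) (auto simp: permutation_permutes)

text \<open>After the exchange \<open>a\<close> leads into the old cycle of \<open>b\<close> at
  \<open>f b\<close>, and the walk meets no changed value before it arrives at
  \<open>b\<close>.\<close>

lemma orbit_fun_upd_swap: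
  assumes "a \<notin> orbit f b" "a \<noteq> b"
  shows "orbit f b \<subseteq> orbit (f(a := f b, b := f a)) a" (is "_ \<subseteq> orbit ?g a")
proof
  have g: "?g c = f c" if "c \<noteq> a" "c \<noteq> b" for c
    using that by simp
  have ga: "?g a = f b" using assms(2) by simp
  fix y assume "y \<in> orbit f b"
  then show "y \<in> orbit ?g a"
  proof induction
    case base
    show ?case using orbit.base[of ?g a] unfolding ga .
  next
    case (step y)
    then have "y \<noteq> a" using assms by auto
    then show ?case
      using orbit.base[of ?g a] orbit.step[OF step.IH] g[of y] unfolding ga by (cases "y = b") metis+
  qed
qed

lemma num_cycles_merge:
  assumes f: "f permutes A" and fin: "finite A" and ab: "a \<in> A" "b \<in> A" and b: "b \<notin> orbit f a"
  shows "Suc (num_cycles (f(a := f b, b := f a)) A) = num_cycles f A"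
proof -
  let ?g = "f(a := f b, b := f a)" and ?a = "orbit f a" and ?b = "orbit f b"
  let ?R = "orbit f ` (A - ?a - ?b)"
  have g: "?g permutes A" using f ab by (rule permutes_fun_upd_swap)
  note eq = orbit_permutes_eq[OF f fin] and self = self_in_orbit_permutes[OF f fin]
  have ne: "a \<noteq> b" using b self by auto
  have a: "a \<notin> ?b" using b eq self by metis
  have A: "?a \<subseteq> A" "?b \<subseteq> A" using f ab by (auto intro: permutes_orbit_subset[THEN subsetD])
  have "?b \<subseteq> orbit ?g a" using a ne by (rule orbit_fun_upd_swap)
  moreover have "?a \<subseteq> orbit ?g b"
    using orbit_fun_upd_swap[OF b] ne by (simp add: fun_upd_twist)
  moreover have "orbit ?g b = orbit ?g a"
    using \<open>?b \<subseteq> orbit ?g a\<close> self[of b] by (intro orbit_permutes_eq[OF g fin]) auto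
  moreover have "orbit ?g a \<subseteq> ?a \<union> ?b"
  proof
    fix y assume "y \<in> orbit ?g a"
    then show "y \<in> ?a \<union> ?b"
      by induction (use ne in \<open>auto intro: orbit.intros\<close>)
  qed
  ultimately have ga: "orbit ?g a = ?a \<union> ?b" by auto
  have in': "orbit ?g x = ?a \<union> ?b" if "x \<in> ?a \<union> ?b" for x
    using orbit_permutes_eq[OF g fin, of x a] that by (simp add: ga)
  have out: "orbit ?g x = orbit f x" if "x \<in> A - ?a - ?b" for x
  proof (rule orbit_cong)
    show "x \<in> orbit f x" by (rule self)
    fix s assume s: "s \<in> orbit f x"
    then have "s \<noteq> a" "s \<noteq> b" using that eq self by blast+
    then show "?g s = f s" by simp
  qed
  have "orbit f ` A = insert ?a (insert ?b ?R)"
    using ab eq by auto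
  moreover have "orbit ?g ` A = insert (?a \<union> ?b) ?R"
  proof -
    have "A = (?a \<union> ?b) \<union> (A - ?a - ?b)" using A by auto
    then have "orbit ?g ` A = orbit ?g ` (?a \<union> ?b) \<union> orbit ?g ` (A - ?a - ?b)"
      by (metis image_Un)
    moreover have "orbit ?g ` (?a \<union> ?b) = {?a \<union> ?b}"
      using in' self[of a] by auto
    moreover have "orbit ?g ` (A - ?a - ?b) = ?R"
      using out by (rule image_cong[OF refl])
    ultimately show ?thesis by simp
  qed
  moreover have "?a \<notin> insert ?b ?R" "?b \<notin> ?R" "?a \<union> ?b \<notin> ?R"
    using self[of a] self[of b] b eq self by auto
  moreover have "finite ?R" using fin by simp
  ultimately show ?thesis by (simp add: num_cycles_def)
qed

text \<open>The exchange closes the segment from \<open>f b\<close> to \<open>a\<close> into a cycle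
  that misses \<open>b\<close>. Exchanging the images once more restores \<open>f\<close>, so the
  count for merging applies in reverse.\<close>

lemma num_cycles_split:
  assumes f: "f permutes A" and fin: "finite A" and ab: "a \<in> A" "b \<in> A" "a \<noteq> b" and b: "b \<in> orbit f a"
  shows "num_cycles (f(a := f b, b := f a)) A = Suc (num_cycles f A)"
proof -
  let ?g = "f(a := f b, b := f a)"
  have g: "?g permutes A" using f ab(1,2) by (rule permutes_fun_upd_swap)
  have a: "a \<in> orbit f b" using orbit_permutes_eq[OF f fin b] self_in_orbit_permutes[OF f fin] by metis
  let ?j = "funpow_dist1 f b a"
  let ?M = "(\<lambda>i. (f ^^ i) b) ` {1..?j}"
  have j: "(f ^^ ?j) b = a" using a by (rule funpow_dist1_prop)
  have nb: "(f ^^ i) b \<noteq> b" if "0 < i" "i \<le> ?j" for i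
    using funpow_neq_less_funpow_dist1[OF a, of 0 i] that j ab(3) by (cases "i = ?j") auto
  have na: "(f ^^ i) b \<noteq> a" if "0 < i" "i < ?j" for i
    using that by (intro funpow_dist1_least) auto
  have ga: "?g a = f b" using ab(3) by simp
  have g': "?g c = f c" if "c \<noteq> a" "c \<noteq> b" for c
    using that by simp
  have first: "f b \<in> ?M" by (rule image_eqI[of _ _ 1]) auto
  have "orbit ?g a \<subseteq> ?M"
  proof
    fix y assume "y \<in> orbit ?g a"
    then show "y \<in> ?M"
    proof induction
      case base
      show ?case unfolding ga by (rule first)
    next
      case (step y)
      then obtain i where i: "1 \<le> i" "i \<le> ?j" "y = (f ^^ i) b" by auto
      show ?case
      proof (cases "i = ?j")
        case True
        then have "y = a" using j i(3) by simp
        then show ?thesis using first by (simp only: ga)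
      next
        case False
        then have "?g y = (f ^^ Suc i) b"
          using g'[of y] na[of i] nb[of i] i by (simp del: fun_upd_apply)
        then show ?thesis using i False by (intro image_eqI[of _ _ "Suc i"]) auto
      qed
    qed
  qed
  moreover have "b \<notin> ?M"
  proof
    assume "b \<in> ?M"
    then obtain i where "b = (f ^^ i) b" "i \<in> {1..?j}" by (rule imageE)
    then show False using nb[of i] by simp
  qed
  ultimately have nm: "b \<notin> orbit ?g a" by blast
  have "?g(a := ?g b, b := ?g a) = f" using ab(3) by (simp add: fun_eq_iff)
  with num_cycles_merge[OF g fin ab(1,2) nm] show ?thesis by (simp only:)
qed

text \<open>A fixed point is a cycle of its own, which is lost when the point is inserted behind
  \<open>q\<close>. New darts enter the face permutations in this way.\<close>

lemma num_cycles_insert: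
  assumes f: "f permutes A" and fin: "finite A" and q: "q \<in> A" "n \<in> A" "q \<noteq> n" and n: "f n = n"
  shows "Suc (num_cycles (f(q := n, n := f q)) A) = num_cycles f A"
proof -
  have "n \<notin> orbit f q"
  proof
    assume "n \<in> orbit f q"
    then have "q \<in> orbit f n"
      using orbit_permutes_eq[OF f fin] self_in_orbit_permutes[OF f fin] by metis
    moreover have "orbit f n = {n}" using n by (simp add: orbit_eq_singleton_iff)
    ultimately show False using q by simp
  qed
  from num_cycles_merge[OF f fin q(1,2) this] n show ?thesis by simp
qed

lemma num_cycles_fixed:
  assumes f: "f permutes A" and "finite A" "finite B" "A \<inter> B = {}"
  shows "num_cycles f (A \<union> B) = num_cycles f A + card B"
proof -
  have B: "orbit f x = {x}" if "x \<in> B" for x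
    unfolding orbit_eq_singleton_iff using permutes_not_in[OF f] assms(4) that by blast
  have "orbit f ` (A \<union> B) = orbit f ` A \<union> (\<lambda>x. {x}) ` B"
    using B by (auto simp: image_Un)
  moreover have "orbit f ` A \<inter> (\<lambda>x. {x}) ` B = {}"
    using permutes_orbit_subset[OF f] assms(4) by fastforce
  moreover have "card ((\<lambda>x. {x}) ` B) = card B" by (intro card_image) auto
  ultimately show ?thesis
    using assms by (simp add: num_cycles_def card_Un_disjoint)
qed

lemma orbit_conj:
  assumes "inj h" and "\<And>x. g (h x) = h (f x)"
  shows "orbit g (h x) = h ` orbit f x"
proof -
  have "(g ^^ n) (h x) = h ((f ^^ n) x)" for n
    by (induction n) (auto simp: assms)
  then show ?thesis by (auto simp: orbit_altdef image_iff)
qed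

lemma num_cycles_conj:
  assumes "inj h" and "\<And>x. g (h x) = h (f x)"
  shows "num_cycles g (h ` A) = num_cycles f A"
proof -
  have "orbit g ` h ` A = (`) h ` orbit f ` A"
    using orbit_conj[of h g f, OF assms] by (simp add: image_image)
  moreover have "inj ((`) h)" using assms(1) by (simp add: inj_image_eq_iff inj_def)
  ultimately show ?thesis
    unfolding num_cycles_def by (simp add: card_image inj_on_subset)
qed

text \<open>The walk of \<open>f\<close> from \<open>x\<close> can differ from that of
  \<open>g\<close> only at \<open>t\<close>, and there it is back at \<open>x\<close>, so nothing
  new is reached afterwards.\<close>

lemma orbit_except:
  assumes "f t = x" "x \<noteq> t" and "\<And>d. d \<in> insert x (orbit f x) \<Longrightarrow> d \<noteq> t \<Longrightarrow> g d = f d"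
  shows "orbit f x \<subseteq> insert x (orbit g x)"
proof
  fix y assume "y \<in> orbit f x"
  then show "y \<in> insert x (orbit g x)"
  proof induction
    case base
    show ?case using assms(2,3) orbit.base[of g x] by auto
  next
    case (step y)
    show ?case
    proof (cases "y = t")
      case False
      then have "f y = g y" using assms(3) step.hyps by simp
      then show ?thesis using step.IH by (auto intro: orbit.intros)
    qed (use assms(1) in simp)
  qed
qed

section \<open>Faces of an arc diagram\<close>

definition word_darts :: "'a list \<Rightarrow> dart set" where
  "word_darts w = {..length w} \<times> UNIV"

text \<open>The edges of an arc diagram with word \<open>w\<close> are numbered along the arc, edge \<open>k\<close> ending at
  passage \<open>k\<close>.  \<open>face_step w\<close> walks along the boundary of a face lying on the right, turning
  right at every crossing and turning round at the two ends of the arc.\<close>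

fun face_step :: "passage list \<Rightarrow> dart \<Rightarrow> dart" where
  "face_step w (k, True) =
     (if k < length w then
        (let y = partner (w ! k) in if rtl (w ! k) then (pos w y, False) else (Suc (pos w y), True))
      else if k = length w then (k, False) else (k, True))"
| "face_step w (0, False) = (0, True)"
| "face_step w (Suc k, False) =
     (if k < length w then
        (let y = partner (w ! k) in if rtl (w ! k) then (Suc (pos w y), True) else (pos w y, False))
      else (Suc k, False))"

lemma face_step_forward:
  assumes "x \<in> set w"
  shows "face_step w (pos w x, True) =
    (if rtl x then (pos w (partner x), False) else (Suc (pos w (partner x)), True))"
  using assms by (simp add: pos_less nth_pos Let_def)

lemma face_step_backward:
  assumes "x \<in> set w"
  shows "face_step w (Suc (pos w x), False) =
    (if rtl x then (Suc (pos w (partner x)), True) else (pos w (partner x), False))"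
  using assms by (simp add: pos_less nth_pos Let_def)

lemma face_step_end: "face_step w (length w, True) = (length w, False)"
  by simp

lemma face_step_outside: "d \<notin> word_darts w \<Longrightarrow> face_step w d = d"
  by (cases "(w, d)" rule: face_step.cases) (auto simp: word_darts_def)

text \<open>A dart runs into a passage, along or against the arc, or into one of the two ends.
  Naming darts by passages keeps track of them when positions shift.\<close>

lemma word_darts_cases:
  assumes "d \<in> word_darts w" "distinct w"
  obtains (forward) x where "x \<in> set w" "d = (pos w x, True)"
    | (backward) x where "x \<in> set w" "d = (Suc (pos w x), False)"
    | (tip) "d = (length w, True)"
    | (root) "d = (0, False)"
proof -
  obtain k b where d: "d = (k, b)" "k \<le> length w" using assms by (auto simp: word_darts_def)
  show ?thesis
  proof (cases b)
    case True
    then show ?thesis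
      using d that(1)[of "w ! k"] that(3) assms(2) by (cases "k = length w") (auto simp: pos_nth)
  next
    case False
    then show ?thesis
      using d that(2)[of "w ! (k - 1)"] that(4) assms(2) by (cases k) (auto simp: pos_nth)
  qed
qed

lemma flip_flip [simp]: "flip (flip d) = d"
  by (simp add: flip_def)

lemma flip_pair [simp]: "flip (k, b) = (k, \<not> b)"
  by (simp add: flip_def)

lemma flip_in_word_darts [simp]: "flip d \<in> word_darts w \<longleftrightarrow> d \<in> word_darts w"
  by (cases d) (auto simp: word_darts_def)

lemma finite_word_darts [simp]: "finite (word_darts w)"
  by (simp add: word_darts_def)

section \<open>Mirror images: over and under stay, left and right are exchanged\<close>

fun mirror :: "passage \<Rightarrow> passage" where
  "mirror (Over c s) = Over c (\<not> s)"
| "mirror (Under c s) = Under c (\<not> s)"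
| "mirror (Virt c b) = Virt c (\<not> b)"

lemma mirror_mirror [simp]: "mirror (mirror x) = x"
  by (cases x) auto

lemma mirror_eq_iff [simp]: "mirror x = mirror y \<longleftrightarrow> x = y"
  by (metis mirror_mirror)

lemma partner_mirror [simp]: "partner (mirror x) = mirror (partner x)"
  by (cases x) auto

lemma mirror_simps [simp]:
  "rtl (mirror x) \<longleftrightarrow> \<not> rtl x" "label (mirror x) = label x" "is_virt (mirror x) \<longleftrightarrow> is_virt x"
  "is_over (mirror x) \<longleftrightarrow> is_over x" "is_under (mirror x) \<longleftrightarrow> is_under x"
  by (cases x; simp)+

lemma inj_mirror: "inj_on mirror A"
  by (simp add: inj_on_def)

lemma pos_mirror [simp]: "pos (map mirror w) (mirror x) = pos w x"
  by (induction w) auto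

lemma crossing_word_mirror: "crossing_word w \<Longrightarrow> crossing_word (map mirror w)"
  by (auto simp: crossing_word_def distinct_map inj_mirror)

lemma face_step_in: "crossing_word w \<Longrightarrow> d \<in> word_darts w \<Longrightarrow> face_step w d \<in> word_darts w"
  using crossing_word_partner[of w] crossing_word_distinct[of w]
  by (elim word_darts_cases)
     (auto simp: face_step_forward face_step_backward face_step_end word_darts_def pos_less Suc_le_eq less_imp_le
       simp del: face_step.simps(1,3))

text \<open>A reflection puts the faces on the left, so a face walk of the mirror image runs
  backwards along the reversed darts. The left inverse obtained here also yields the injectivity of
  \<open>face_step w\<close>.\<close>

lemma face_step_mirror:
  assumes "crossing_word w" "d \<in> word_darts w"
  shows "face_step (map mirror w) (flip (face_step w d)) = flip d"
  using assms(2) crossing_word_distinct[OF assms(1)]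
proof (cases rule: word_darts_cases)
  case (forward x)
  have "mirror (partner x) \<in> set (map mirror w)"
    using crossing_word_partner[OF assms(1) forward(1)] by simp
  from face_step_forward[OF this] face_step_backward[OF this] forward show ?thesis
    by (simp add: face_step_forward del: face_step.simps)
next
  case (backward x)
  have "mirror (partner x) \<in> set (map mirror w)"
    using crossing_word_partner[OF assms(1) backward(1)] by simp
  from face_step_forward[OF this] face_step_backward[OF this] backward show ?thesis
    by (simp add: face_step_backward del: face_step.simps)
next
  case tip
  show ?thesis using face_step_end[of "map mirror w"] by (simp add: tip)
qed simp

lemma face_step_permutes:
  assumes "crossing_word w"
  shows "face_step w permutes word_darts w"
proof (rule bij_imp_permutes)
  have "inj_on (face_step w) (word_darts w)"
    by (rule inj_onI) (metis assms face_step_mirror flip_flip)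
  then show "bij_betw (face_step w) (word_darts w) (word_darts w)"
    using face_step_in[OF assms] by (simp add: bij_betw_def endo_inj_surj image_subset_iff)
qed (rule face_step_outside)

lemma orbit_face_step_mirror:
  assumes "crossing_word w"
  shows "orbit (face_step (map mirror w)) (flip d) = flip ` orbit (face_step w) d"
proof -
  let ?f = "face_step w"
  note p = face_step_permutes[OF assms]
  have "face_step (map mirror w) (flip d) = flip (inv ?f d)" for d
  proof (cases "d \<in> word_darts w")
    case True
    then have "inv ?f d \<in> word_darts w" using p by (simp add: permutes_in_image[OF permutes_inv])
    from face_step_mirror[OF assms this] show ?thesis
      by (simp add: permutes_inverses[OF p])
  next
    case False
    then have "inv ?f d = d" using p by (simp add: permutes_not_in[OF permutes_inv])
    moreover have "flip d \<notin> word_darts (map mirror w)" using False by (auto simp: word_darts_def flip_def mem_Times_iff)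
    ultimately show ?thesis using face_step_outside by metis
  qed
  moreover have "inj flip" by (rule inj_on_inverseI[where g = flip]) simp
  ultimately have "orbit (face_step (map mirror w)) (flip d) = flip ` orbit (inv ?f) d"
    by (rule orbit_conj[rotated])
  also have "orbit (inv ?f) d = orbit ?f d"
    using p finite_word_darts by (intro orbit_inv_eq) (auto simp only: permutation_permutes)
  finally show ?thesis .
qed

text \<open>\<open>planar w\<close> says that the arc diagram has Euler characteristic 2: it has \<open>length w div 2 + 2\<close>
  vertices and \<open>length w + 1\<close> edges.  \<open>closable w\<close> says that its two ends lie on a common face.\<close>

definition planar :: "passage list \<Rightarrow> bool" where
  "planar w \<longleftrightarrow> crossing_word w \<and> 2 * num_cycles (face_step w) (word_darts w) = length w + 2"

definition closable :: "passage list \<Rightarrow> bool" where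
  "closable w \<longleftrightarrow> (0, False) \<in> orbit (face_step w) (length w, True)"

lemma planar_crossing_word: "planar w \<Longrightarrow> crossing_word w"
  by (simp add: planar_def)

lemma planar_mirror:
  assumes "planar w"
  shows "planar (map mirror w)"
proof -
  have cw: "crossing_word w" using assms by (rule planar_crossing_word)
  have "inj ((`) flip)" by (rule inj_on_inverseI[where g = "(`) flip"]) (simp add: image_image)
  have "word_darts (map mirror w) = flip ` word_darts w"
    by (auto simp: word_darts_def flip_def image_iff)
  then have "orbit (face_step (map mirror w)) ` word_darts (map mirror w) =
      (`) flip ` orbit (face_step w) ` word_darts w"
    by (simp add: image_image orbit_face_step_mirror[OF cw])
  then have "num_cycles (face_step (map mirror w)) (word_darts (map mirror w)) =
      num_cycles (face_step w) (word_darts w)"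
    unfolding num_cycles_def using \<open>inj ((`) flip)\<close> by (simp add: card_image inj_on_subset)
  then show ?thesis using assms by (simp add: planar_def crossing_word_mirror)
qed

lemma same_face_sym:
  assumes "crossing_word w" "d \<in> orbit (face_step w) d'"
  shows "d' \<in> orbit (face_step w) d"
  using orbit_permutes_eq[OF face_step_permutes[OF assms(1)] _ assms(2)]
    self_in_orbit_permutes[OF face_step_permutes[OF assms(1)]] by simp

text \<open>Reversal exchanges the darts running into an end with those leaving it, but a face walk
  turns round at the ends, so both lie on the same face.\<close>

lemma closable_mirror:
  assumes "crossing_word w" "closable w"
  shows "closable (map mirror w)"
proof -
  let ?g = "face_step (map mirror w)"
  note cw = crossing_word_mirror[OF assms(1)]
  have "flip (0, False) \<in> orbit ?g (flip (length w, True))"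
    using assms(2) unfolding orbit_face_step_mirror[OF assms(1)] closable_def by (rule imageI)
  then have a: "(0, True) \<in> orbit ?g (length w, False)" by simp
  have "(length w, False) \<in> orbit ?g (length w, True)"
    using orbit.base[of ?g "(length w, True)"] face_step_end[of "map mirror w"] by simp
  with a have b: "(0, True) \<in> orbit ?g (length w, True)" by (rule orbit_trans)
  have "(0, True) \<in> orbit ?g (0, False)" using orbit.base[of ?g "(0, False)"] by simp
  then have "(0, False) \<in> orbit ?g (0, True)" by (rule same_face_sym[OF cw])
  then show ?thesis using b unfolding closable_def length_map by (rule orbit_trans)
qed

lemma planar_Nil: "planar []"
proof -
  have "word_darts ([] :: passage list) = {(0, True), (0, False)}"
    by (auto simp: word_darts_def)
  moreover have "orbit (face_step []) (0, True) = orbit (face_step []) (0, False)"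
    by (rule orbit_permutes_eq[of _ "word_darts ([] :: passage list)"])
       (auto intro!: face_step_permutes orbit_eqI simp: crossing_word_def)
  ultimately show ?thesis
    by (simp add: planar_def crossing_word_def num_cycles_def)
qed

lemma closable_Nil: "closable []"
  unfolding closable_def by (rule orbit_eqI) simp

section \<open>Letting an arc grow\<close>

lemma crossing_word_grow:
  assumes "crossing_word (u @ v)" "label x \<notin> label ` set (u @ v)"
  shows "crossing_word (u @ [partner x] @ v @ [x])"
proof -
  have "x \<notin> set (u @ v)" "partner x \<notin> set (u @ v)"
    using assms(2) label_partner[of x] by (metis imageI)+
  moreover have "label y \<noteq> label x" "label x \<noteq> label y" if "y \<in> set (u @ v)" for y
    using assms(2) that by (metis imageI)+
  ultimately show ?thesis
    using assms(1) unfolding crossing_word_def by auto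
qed

text \<open>The fixed points are inserted one after another, each behind an element that may itself
  just have been inserted; every insertion absorbs a cycle of length one.\<close>

lemma num_cycles_four_insertions:
  fixes f :: "'a \<Rightarrow> 'a"
  assumes "f permutes A" "finite A"
    and "{a, b, c, d, p, q, r, s} \<subseteq> A" and "distinct [a, b, c, d]"
    and "f a = a" "f b = b" "f c = c" "f d = d"
    and "p \<notin> {a, b, c, d}" "q \<notin> {b, c, d}" "r \<notin> {c, d}" "s \<noteq> d"
  defines "f1 \<equiv> f(p := a, a := f p)"
  defines "f2 \<equiv> f1(q := b, b := f1 q)"
  defines "f3 \<equiv> f2(r := c, c := f2 r)"
  defines "f4 \<equiv> f3(s := d, d := f3 s)"
  shows "num_cycles f4 A + 4 = num_cycles f A"
proof -
  have 1: "f1 permutes A" "Suc (num_cycles f1 A) = num_cycles f A"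
    using permutes_fun_upd_swap[of f A p a] num_cycles_insert[of f A p a] assms(1-12)
    by (auto simp: f1_def)
  have f1: "f1 b = b" "f1 c = c" "f1 d = d" using assms(4-12) by (auto simp: f1_def)
  have 2: "f2 permutes A" "Suc (num_cycles f2 A) = num_cycles f1 A"
    using permutes_fun_upd_swap[of f1 A q b] num_cycles_insert[of f1 A q b] assms(2-12) 1 f1
    by (auto simp: f2_def)
  have f2: "f2 c = c" "f2 d = d" using assms(4-12) f1 by (auto simp: f2_def)
  have 3: "f3 permutes A" "Suc (num_cycles f3 A) = num_cycles f2 A"
    using permutes_fun_upd_swap[of f2 A r c] num_cycles_insert[of f2 A r c] assms(2-12) 2 f2
    by (auto simp: f3_def)
  have f3: "f3 d = d" using assms(4-12) f2 by (auto simp: f3_def)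
  have 4: "Suc (num_cycles f4 A) = num_cycles f3 A"
    using num_cycles_insert[of f3 A s d] assms(2-12) 3 f3 by (auto simp: f4_def)
  show ?thesis using 1 2 3 4 by simp
qed

text \<open>The tip crosses edge \<open>length u\<close>, coming from its left if
  \<open>rtl x\<close> and from its right otherwise. As faces lie to the right of their darts,
  \<open>face\<close> says that the tip and this side of the edge share a face. The crossing adds
  one vertex and two edges, so exactly one face has to be gained. With \<open>v = []\<close> the tip
  would cross its own last edge; that case is a curl.\<close>

lemma planar_grow:
  assumes pl: "planar (u @ v)" and v: "v \<noteq> []" and x: "label x \<notin> label ` set (u @ v)"
    and face: "(length u, \<not> rtl x) \<in> orbit (face_step (u @ v)) (length (u @ v), True)"
  shows "planar (u @ [partner x] @ v @ [x])"
proof -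
  define w w' where "w = u @ v" and "w' = u @ [partner x] @ v @ [x]"
  define m n where "m = length u" and "n = length w"
  let ?f = "face_step w" and ?A = "word_darts w" and ?A' = "word_darts w'"
  have cw: "crossing_word w" using pl by (simp add: w_def planar_crossing_word)
  have cw': "crossing_word w'" unfolding w'_def using cw x by (intro crossing_word_grow) (simp_all add: w_def)
  note dist = crossing_word_distinct[OF cw] and dist' = crossing_word_distinct[OF cw']
  note part = crossing_word_partner[OF cw]
  have mn: "m < n" using v by (simp add: m_def n_def w_def)
  have len': "length w' = Suc (Suc n)" by (simp add: w'_def n_def w_def)
  have new: "x \<noteq> y" "partner x \<noteq> y" if "y \<in> set w" for y
    using x that label_partner[of x] unfolding w_def by (metis imageI)+

  text \<open>\<open>H\<close> renumbers the old darts so that an edge that is cut passes its number on to its first half;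
    the second halves are the new edges \<open>Suc m\<close> and \<open>Suc (Suc n)\<close>.  Up to the four inserted darts of
    these, the new face permutation is the old one with the images of two darts of the common face
    interchanged, so this face splits and all others persist.\<close>
  define \<eta> where "\<eta> k = (if k \<le> m \<or> Suc n < k then k else if k = Suc n then Suc m else Suc k)" for k
  define H where "H d = (\<eta> (fst d), snd d)" for d :: dart
  have "inj \<eta>" using mn by (auto simp: inj_def \<eta>_def split: if_splits)
  then have injH: "inj H" by (auto simp: inj_def H_def prod_eq_iff)
  have HA: "H ` ?A' = ?A'"
    using injH by (intro endo_inj_surj)
      (use mn in \<open>auto simp: word_darts_def H_def \<eta>_def len' intro: inj_on_subset\<close>)
  have Hperm: "H permutes ?A'"
    using injH HA by (intro bij_imp_permutes)
      (use mn in \<open>auto simp: bij_betw_def word_darts_def H_def \<eta>_def len' intro: inj_on_subset\<close>)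
  define \<Phi> where "\<Phi> = H \<circ> ?f \<circ> inv H"
  have \<Phi>H: "\<Phi> (H d) = H (?f d)" for d
    using injH by (simp add: \<Phi>_def del: face_step.simps)
  have "?A \<subseteq> ?A'" by (auto simp: word_darts_def len' n_def)
  then have "?f permutes ?A'" using face_step_permutes[OF cw] by (rule permutes_subset[rotated])
  then have \<Phi>perm: "\<Phi> permutes ?A'"
    unfolding \<Phi>_def using Hperm by (intro permutes_compose permutes_inv)
  have "?A' = ?A \<union> {Suc n, Suc (Suc n)} \<times> UNIV"
    by (auto simp: word_darts_def len' n_def)
  moreover have "num_cycles ?f (?A \<union> {Suc n, Suc (Suc n)} \<times> UNIV) = num_cycles ?f ?A + card ({Suc n, Suc (Suc n)} \<times> (UNIV :: bool set))"
    by (rule num_cycles_fixed[OF face_step_permutes[OF cw]]) (auto simp: word_darts_def n_def)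
  ultimately have "num_cycles ?f ?A' = num_cycles ?f ?A + 4" by simp
  moreover have "num_cycles \<Phi> (H ` ?A') = num_cycles ?f ?A'"
    using injH \<Phi>H by (rule num_cycles_conj)
  ultimately have cyc: "num_cycles \<Phi> ?A' = num_cycles ?f ?A + 4" by (simp add: HA)

  \<comment> \<open>The cut edge has the halves \<open>?e\<close> and \<open>?a\<close>, the last
    edge the halves \<open>?l\<close> and \<open>?b\<close>; the suffix \<open>F\<close> marks a
    reversed dart.\<close>
  let ?l = "(Suc n, True)" and ?e = "(m, True)" and ?eF = "(m, False)" and ?a = "(Suc m, True)"
    and ?aF = "(Suc m, False)" and ?b = "(Suc (Suc n), True)" and ?bF = "(Suc (Suc n), False)"
  have Hl: "H (n, c) = (Suc n, c)" and He: "H (m, c) = (m, c)" for c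
    using mn by (simp_all add: H_def \<eta>_def)
  have \<Phi>new: "\<Phi> (Suc m, c) = (Suc m, c)" "\<Phi> (Suc (Suc n), c) = (Suc (Suc n), c)" for c
  proof -
    have "?f (Suc n, c) = (Suc n, c)" "?f (Suc (Suc n), c) = (Suc (Suc n), c)"
      by (rule face_step_outside, simp add: word_darts_def n_def)+
    then show "\<Phi> (Suc m, c) = (Suc m, c)" "\<Phi> (Suc (Suc n), c) = (Suc (Suc n), c)"
      using \<Phi>H[of "(Suc n, c)"] \<Phi>H[of "(Suc (Suc n), c)"] mn by (simp_all add: H_def \<eta>_def)
  qed
  have \<Phi>l: "\<Phi> ?l = (Suc n, False)"
    using \<Phi>H[of "(n, True)"] face_step_end[of w] by (simp add: Hl flip: n_def del: face_step.simps)
  \<comment> \<open>A walk in the direction of the arc turns round only at the tip, hence not on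
    edge \<open>m\<close>; this separates \<open>q\<close> from \<open>?e\<close>.\<close>
  have \<Phi>e: "\<Phi> ?e \<noteq> ?eF"
  proof
    assume "\<Phi> ?e = ?eF"
    then have "H (?f (m, True)) = H (m, False)"
      using \<Phi>H[of "(m, True)"] unfolding He by metis
    then have "?f (m, True) = (m, False)" using injH by (simp add: inj_eq del: face_step.simps)
    moreover obtain y where y: "y \<in> set w" "pos w y = m"
      using mn dist by (metis n_def nth_mem pos_nth)
    ultimately have "pos w (partner y) = pos w y"
      using face_step_forward[OF y(1)] by (simp del: face_step.simps split: if_splits)
    then show False using part[OF y(1)] y(1) by (metis partner_neq(1) pos_inj)
  qed
  \<comment> \<open>\<open>q\<close> precedes \<open>?eF\<close> in the old face. Walking the cut
    edge backwards now begins with its second half, so \<open>q\<close> has to lead to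
    \<open>?aF\<close>.\<close>
  define q where "q = inv \<Phi> ?eF"
  have q: "\<Phi> d = ?eF \<longleftrightarrow> d = q" for d
    unfolding q_def using permutes_inverses[OF \<Phi>perm] by metis
  have q_in: "q \<in> ?A'"
  proof -
    have "?eF \<in> ?A'" using mn by (simp add: word_darts_def len')
    then show ?thesis using permutes_in_image[OF \<Phi>perm, of q] q[of q] by simp
  qed
  have q_ne: "q \<noteq> ?l" "q \<noteq> ?e" "q \<noteq> ?a" "q \<noteq> ?aF" "q \<noteq> ?b" "q \<noteq> ?bF"
    using \<Phi>l \<Phi>e \<Phi>new q[of ?l] q[of ?e] q[of ?a] q[of ?aF] q[of ?b] q[of ?bF] mn by auto

  have pos_old: "pos w' y = (if pos w y < m then pos w y else Suc (pos w y))" if "y \<in> set w" for y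
    using that new[OF that] by (auto simp: w'_def w_def m_def pos_append pos_less)
  have pos_px: "pos w' (partner x) = m" and pos_x: "pos w' x = Suc n"
    using dist' by (auto simp: w'_def w_def m_def n_def pos_append)
  have Hf: "H (pos w y, c) = (if pos w y = m then (m, c) else (pos w' y, c))"
      and Hb: "H (Suc (pos w y), c) = (Suc (pos w' y), c)" if "y \<in> set w" for y c
    using pos_less[OF that] mn by (auto simp: H_def \<eta>_def pos_old[OF that] n_def)
  have turn: "(pos w' y, False) = (if d = ?eF then ?aF else H d)" if "y \<in> set w" "d = (pos w y, False)" for y d
    using Hf[OF that(1)] that pos_old[OF that(1)] by auto
  have sub: "y \<in> set w'" if "y \<in> set w" for y
    using that by (auto simp: w_def w'_def)
  have forward: "face_step w' (pos w' y, True) = (if ?f (pos w y, True) = ?eF then ?aF else H (?f (pos w y, True)))"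
    if "y \<in> set w" for y
    using face_step_forward[OF that] face_step_forward[OF sub[OF that]] turn[OF part[OF that]]
      Hb[OF part[OF that]] by (auto simp del: face_step.simps)
  have backward: "face_step w' (Suc (pos w' y), False) =
      (if ?f (Suc (pos w y), False) = ?eF then ?aF else H (?f (Suc (pos w y), False)))"
    if "y \<in> set w" for y
    using face_step_backward[OF that] face_step_backward[OF sub[OF that]] turn[OF part[OF that]]
      Hb[OF part[OF that]] by (auto simp del: face_step.simps)
  have H_eF: "?f d = ?eF \<longleftrightarrow> H d = q" for d
    using q[of "H d"] \<Phi>H[of d] injH He[of False] by (metis inj_eq)
  have fwd: "face_step w' (pos w' y, True) = (if (pos w' y, True) = q then ?aF else \<Phi> (pos w' y, True))"
    if "y \<in> set w" "pos w y \<noteq> m" for y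
    using forward[OF that(1)] H_eF[of "(pos w y, True)"] \<Phi>H[of "(pos w y, True)"] Hf[OF that(1), of True] that(2)
    by (simp del: face_step.simps)
  have bwd: "face_step w' (Suc (pos w' y), False) = (if (Suc (pos w' y), False) = q then ?aF else \<Phi> (Suc (pos w' y), False))"
    if "y \<in> set w" for y
    using backward[OF that] H_eF[of "(Suc (pos w y), False)"] \<Phi>H[of "(Suc (pos w y), False)"] Hb[OF that, of False]
    by (simp del: face_step.simps)
  have mid: "face_step w' ?a = \<Phi> ?e"
  proof -
    obtain y where y: "y \<in> set w" "pos w y = m"
      using mn dist by (metis n_def nth_mem pos_nth)
    then show ?thesis
      using forward[OF y(1)] pos_old[OF y(1)] H_eF[of ?e] q_ne \<Phi>H[of ?e] He[of True] by (simp del: face_step.simps)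
  qed
  have xs: "x \<in> set w'" "partner x \<in> set w'" by (auto simp: w'_def)
  have at_new: "face_step w' ?e = (if rtl x then ?b else (Suc n, False))"
      "face_step w' ?aF = (if rtl x then (Suc n, False) else ?b)"
      "face_step w' ?l = (if rtl x then ?eF else ?a)"
      "face_step w' ?bF = (if rtl x then ?a else ?eF)"
      "face_step w' ?b = ?bF"
    using face_step_forward[OF xs(1)] face_step_forward[OF xs(2)]
      face_step_backward[OF xs(1)] face_step_backward[OF xs(2)]
    by (simp_all add: pos_px pos_x len' del: face_step.simps(1,3)) (simp add: len')
  have root: "face_step w' (0, False) = \<Phi> (0, False)" "(0, False) \<noteq> q"
  proof -
    show 1: "face_step w' (0, False) = \<Phi> (0, False)"
      using \<Phi>H[of "(0, False)"] by (simp add: H_def \<eta>_def)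
    then show "(0, False) \<noteq> q" using q[of "(0, False)"] by auto
  qed
  have outside: "face_step w' d = \<Phi> d" "d \<noteq> q" if "d \<notin> ?A'" for d
    using face_step_outside[OF that] permutes_not_in[OF \<Phi>perm that] q_in that by auto
  have old_key: "(pos w' y, True) \<notin> {?l, ?e, ?a, ?b}" if "y \<in> set w" "pos w y \<noteq> m" for y
    using that pos_less[OF that(1)] pos_old[OF that(1)] mn by (auto simp: n_def)
  have old_key': "(Suc (pos w' y), False) \<notin> {?aF, ?bF}" if "y \<in> set w" for y
    using that pos_less[OF that(1)] pos_old[OF that(1)] mn by (auto simp: n_def)
  have dart_cases: "P d" if
      "\<And>y. y \<in> set w \<Longrightarrow> pos w y \<noteq> m \<Longrightarrow> P (pos w' y, True)"
      "\<And>y. y \<in> set w \<Longrightarrow> P (Suc (pos w' y), False)"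
      "P ?e" "P ?a" "P ?aF" "P ?l" "P ?b" "P ?bF" "P (0, False)" "\<And>d. d \<notin> ?A' \<Longrightarrow> P d" for P d
  proof (cases "d \<in> ?A'")
    case True
    have set': "set w' = {x, partner x} \<union> set w" by (auto simp: w_def w'_def)
    from True dist' show ?thesis
    proof (cases rule: word_darts_cases)
      case (forward y)
      then show ?thesis
        using that(1)[of y] that(3,4,6) set' pos_px pos_x pos_old[of y] by (cases "pos w y = m") auto
    next
      case (backward y)
      then show ?thesis using that(2)[of y] that(5,8) set' pos_px pos_x by auto
    qed (use that(7,9) in \<open>auto simp: len'\<close>)
  qed (rule that(10))

  have orb: "H d \<in> orbit \<Phi> ?l" if "d \<in> orbit ?f (n, True)" for d
    using orbit_conj[OF injH, of \<Phi> ?f "(n, True)"] \<Phi>H that by (simp add: Hl del: face_step.simps)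
  have face': "(m, \<not> rtl x) \<in> orbit ?f (n, True)"
    using face by (simp only: w_def m_def n_def)
  note fin = finite_word_darts[of w']
  have keys: "?l \<in> ?A'" "?e \<in> ?A'" "{?a, ?aF, ?b, ?bF} \<subseteq> ?A'"
    using mn by (auto simp: word_darts_def len')
  have "num_cycles (face_step w') ?A' = Suc (num_cycles ?f ?A)"
  proof (cases "rtl x")
    case False
    \<comment> \<open>At the new crossing the walks along \<open>?l\<close> and \<open>?e\<close>
      both turn onto the other strand, so their continuations are exchanged; the common face
      splits.\<close>
    define g where "g = \<Phi>(?l := \<Phi> ?e, ?e := \<Phi> ?l)"
    have e: "?e \<in> orbit \<Phi> ?l"
      using orb[OF face'] False He[of True] by simp
    have g: "g permutes ?A'" "num_cycles g ?A' = Suc (num_cycles \<Phi> ?A')"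
      unfolding g_def using permutes_fun_upd_swap[OF \<Phi>perm keys(1,2)] num_cycles_split[OF \<Phi>perm fin keys(1,2) _ e] mn by auto
    have gfix: "g ?a = ?a" "g ?bF = ?bF" "g ?b = ?b" "g ?aF = ?aF"
      using mn \<Phi>new by (auto simp: g_def)
    \<comment> \<open>Insertions behind the same dart stack up in reverse order: the result leads
      from \<open>q\<close> through \<open>?aF\<close>, \<open>?b\<close> and \<open>?bF\<close> to
      \<open>?eF\<close>.\<close>
    define g1 where "g1 = g(?l := ?a, ?a := g ?l)"
    define g2 where "g2 = g1(q := ?bF, ?bF := g1 q)"
    define g3 where "g3 = g2(q := ?b, ?b := g2 q)"
    define g4 where "g4 = g3(q := ?aF, ?aF := g3 q)"
    have "num_cycles g4 ?A' + 4 = num_cycles g ?A'"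
      unfolding g4_def g3_def g2_def g1_def
      by (rule num_cycles_four_insertions[of g ?A' ?a ?bF ?b ?aF ?l q q q, OF g(1) fin])
        (use keys q_in q_ne gfix mn in auto)
    moreover have "face_step w' = g4"
    proof
      fix d show "face_step w' d = g4 d"
      proof (rule dart_cases[where P = "\<lambda>d. face_step w' d = g4 d"])
        show "face_step w' (pos w' y, True) = g4 (pos w' y, True)" if "y \<in> set w" "pos w y \<noteq> m" for y
          using fwd[OF that] old_key[OF that] unfolding g4_def g3_def g2_def g1_def g_def by auto
        show "face_step w' (Suc (pos w' y), False) = g4 (Suc (pos w' y), False)" if "y \<in> set w" for y
          using bwd[OF that] old_key'[OF that] unfolding g4_def g3_def g2_def g1_def g_def by auto
        show "face_step w' d = g4 d" if "d \<notin> ?A'" for d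
          using outside[OF that] that keys unfolding g4_def g3_def g2_def g1_def g_def by auto
      qed (use False mn at_new mid root q_ne \<Phi>l q[of q] in
            \<open>auto simp: g4_def g3_def g2_def g1_def g_def simp del: face_step.simps\<close>)
    qed
    ultimately show ?thesis using g(2) cyc by simp
  next
    case True
    \<comment> \<open>Here the face of the tip meets the cut edge as \<open>?eF\<close>, so its
      predecessor \<open>q\<close> takes the role that \<open>?e\<close> has in the other
      case.\<close>
    define g where "g = \<Phi>(?l := \<Phi> q, q := \<Phi> ?l)"
    have "?eF \<in> orbit \<Phi> ?l"
      using orb[OF face'] True He[of False] by simp
    moreover have "?eF \<in> orbit \<Phi> q" using orbit.base[of \<Phi> q] q[of q] by simp
    ultimately have qo: "q \<in> orbit \<Phi> ?l"
      using orbit_permutes_eq[OF \<Phi>perm fin] self_in_orbit_permutes[OF \<Phi>perm fin] by metis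
    have g: "g permutes ?A'" "num_cycles g ?A' = Suc (num_cycles \<Phi> ?A')"
      unfolding g_def using permutes_fun_upd_swap[OF \<Phi>perm keys(1) q_in] num_cycles_split[OF \<Phi>perm fin keys(1) q_in _ qo] q_ne by auto
    have gfix: "g ?a = ?a" "g ?bF = ?bF" "g ?b = ?b" "g ?aF = ?aF"
      using mn \<Phi>new q_ne by (auto simp: g_def)
    define g1 where "g1 = g(q := ?aF, ?aF := g q)"
    define g2 where "g2 = g1(?e := ?a, ?a := g1 ?e)"
    define g3 where "g3 = g2(?e := ?bF, ?bF := g2 ?e)"
    define g4 where "g4 = g3(?e := ?b, ?b := g3 ?e)"
    have "num_cycles g4 ?A' + 4 = num_cycles g ?A'"
      unfolding g4_def g3_def g2_def g1_def
      by (rule num_cycles_four_insertions[of g ?A' ?aF ?a ?bF ?b q ?e ?e ?e, OF g(1) fin])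
        (use keys q_in q_ne gfix mn in auto)
    moreover have "face_step w' = g4"
    proof
      fix d show "face_step w' d = g4 d"
      proof (rule dart_cases[where P = "\<lambda>d. face_step w' d = g4 d"])
        show "face_step w' (pos w' y, True) = g4 (pos w' y, True)" if "y \<in> set w" "pos w y \<noteq> m" for y
          using fwd[OF that] old_key[OF that] unfolding g4_def g3_def g2_def g1_def g_def by auto
        show "face_step w' (Suc (pos w' y), False) = g4 (Suc (pos w' y), False)" if "y \<in> set w" for y
          using bwd[OF that] old_key'[OF that] unfolding g4_def g3_def g2_def g1_def g_def by auto
        show "face_step w' d = g4 d" if "d \<notin> ?A'" for d
          using outside[OF that] that keys unfolding g4_def g3_def g2_def g1_def g_def by auto
      qed (use True mn at_new mid root q_ne \<Phi>l q[of q] in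
            \<open>auto simp: g4_def g3_def g2_def g1_def g_def simp del: face_step.simps\<close>)
    qed
    ultimately show ?thesis using g(2) cyc by simp
  qed
  then have "planar w'" using pl cw' by (simp add: planar_def len' n_def w_def)
  then show ?thesis by (simp add: w'_def)
qed

declare face_step.simps [simp del]

lemma face_step_root: "face_step w (0, False) = (0, True)"
  by (simp add: face_step.simps)

text \<open>Three of the four new darts lengthen the face at the tip, while \<open>?aF\<close> stays
  fixed: it bounds the loop, which is the new face.\<close>

lemma planar_curl:
  assumes pl: "planar w" and x: "label x \<notin> label ` set w" and r: "rtl x"
  shows "planar (w @ [partner x, x])"
proof -
  let ?w = "w @ [partner x, x]" and ?f = "face_step w" and ?n = "length w"
  let ?A = "word_darts w" and ?A' = "word_darts ?w"
  have cw: "crossing_word w" using pl by (rule planar_crossing_word)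
  have cw': "crossing_word ?w" using crossing_word_grow[of w "[]" x] cw x by simp
  note dist' = crossing_word_distinct[OF cw']
  note p = face_step_permutes[OF cw]
  let ?l = "(?n, True)" and ?a = "(Suc ?n, True)" and ?aF = "(Suc ?n, False)"
    and ?b = "(Suc (Suc ?n), True)" and ?bF = "(Suc (Suc ?n), False)"
  have "?A \<subseteq> ?A'" by (auto simp: word_darts_def)
  then have p': "?f permutes ?A'" using p by (rule permutes_subset[rotated])
  note fin = finite_word_darts[of ?w]
  have "?A' = ?A \<union> {Suc ?n, Suc (Suc ?n)} \<times> UNIV"
    by (auto simp: word_darts_def)
  moreover have "num_cycles ?f (?A \<union> {Suc ?n, Suc (Suc ?n)} \<times> UNIV) = num_cycles ?f ?A + card ({Suc ?n, Suc (Suc ?n)} \<times> (UNIV :: bool set))"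
    by (rule num_cycles_fixed[OF p]) (auto simp: word_darts_def)
  ultimately have cyc: "num_cycles ?f ?A' = num_cycles ?f ?A + 4" by simp
  have fixd: "?f ?a = ?a" "?f ?aF = ?aF" "?f ?b = ?b" "?f ?bF = ?bF"
    by (rule face_step_outside, simp add: word_darts_def)+
  have keys: "?l \<in> ?A'" "?a \<in> ?A'" "?b \<in> ?A'" "?bF \<in> ?A'"
    by (auto simp: word_darts_def)
  define f1 where "f1 = ?f(?l := ?a, ?a := ?f ?l)"
  define f2 where "f2 = f1(?l := ?bF, ?bF := f1 ?l)"
  define f3 where "f3 = f2(?l := ?b, ?b := f2 ?l)"
  have 1: "f1 permutes ?A'" "Suc (num_cycles f1 ?A') = num_cycles ?f ?A'" "f1 ?b = ?b" "f1 ?bF = ?bF"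
    using permutes_fun_upd_swap[OF p' keys(1,2)] num_cycles_insert[OF p' fin keys(1,2)] fixd
    by (auto simp: f1_def)
  have 2: "f2 permutes ?A'" "Suc (num_cycles f2 ?A') = num_cycles f1 ?A'" "f2 ?b = ?b"
    using permutes_fun_upd_swap[OF 1(1) keys(1,4)] num_cycles_insert[OF 1(1) fin keys(1,4)] 1
    by (auto simp: f2_def)
  have 3: "Suc (num_cycles f3 ?A') = num_cycles f2 ?A'"
    using num_cycles_insert[OF 2(1) fin keys(1,3)] 2 by (auto simp: f3_def)
  have old: "pos ?w y = pos w y" if "y \<in> set w" for y
    using that by (simp add: pos_append)
  have px: "pos ?w (partner x) = ?n" "pos ?w x = Suc ?n"
    using dist' by (auto simp: pos_append)
  have "face_step ?w = f3"
  proof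
    fix d
    show "face_step ?w d = f3 d"
    proof (cases "d \<in> ?A'")
      case True
      then show ?thesis using dist'
      proof (cases rule: word_darts_cases)
        case (forward y)
        then consider "y \<in> set w" | "y = x" | "y = partner x" by auto
        then show ?thesis
        proof cases
          case 1
          then have "face_step ?w d = ?f d"
            using forward face_step_forward[of y w] face_step_forward[of y ?w]
              crossing_word_partner[OF cw 1] by (simp add: old)
          then show ?thesis using forward pos_less[OF 1] by (auto simp: old[OF 1] f3_def f2_def f1_def)
        qed (use forward face_step_forward[OF forward(1)] face_step_end[of w] r in
              \<open>auto simp: px f3_def f2_def f1_def\<close>)
      next
        case (backward y)
        then consider "y \<in> set w" | "y = x" | "y = partner x" by auto
        then show ?thesis
        proof cases
          case 1
          then have "face_step ?w d = ?f d"
            using backward face_step_backward[of y w] face_step_backward[of y ?w]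
              crossing_word_partner[OF cw 1] by (simp add: old)
          then show ?thesis using backward pos_less[OF 1] by (auto simp: old[OF 1] f3_def f2_def f1_def)
        qed (use backward face_step_backward[OF backward(1)] fixd r in
              \<open>auto simp: px f3_def f2_def f1_def\<close>)
      next
        case tip
        then show ?thesis using face_step_end[of ?w] by (simp add: f3_def f2_def f1_def)
      qed (auto simp: face_step_root f3_def f2_def f1_def)
    next
      case False
      then have "d \<notin> ?A" "d \<notin> {?l, ?a, ?b, ?bF}"
        using \<open>?A \<subseteq> ?A'\<close> keys by auto
      then show ?thesis
        using False by (auto simp: face_step_outside f3_def f2_def f1_def)
    qed
  qed
  then show ?thesis
    using 1(2) 2(2) 3 cyc pl cw' by (simp add: planar_def)
qed

text \<open>Appending passages only changes what a face walk does at the old tip; from there a walk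
  around the old part of the arc comes back.\<close>

lemma prefix_face:
  assumes w: "crossing_word w" and wz: "crossing_word (w @ z)"
  shows "(length w, True) \<in> orbit (face_step (w @ z)) (length w, False)"
    and "closable w \<Longrightarrow> (0, False) \<in> orbit (face_step (w @ z)) (length w, False)"
proof -
  let ?f = "face_step w" and ?g = "face_step (w @ z)" and ?t = "(length w, True)" and ?x = "(length w, False)"
  note self = self_in_orbit_permutes[OF face_step_permutes[OF wz] finite_word_darts]
  have agree: "?g d = ?f d" if "d \<in> insert ?x (orbit ?f ?x)" "d \<noteq> ?t" for d
  proof -
    have "?x \<in> word_darts w" by (simp add: word_darts_def)
    then have "d \<in> word_darts w"
      using that(1) permutes_orbit_subset[OF face_step_permutes[OF w], of ?x] by blast
    then show ?thesis using crossing_word_distinct[OF w]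
    proof (cases rule: word_darts_cases)
      case (forward y)
      have "pos (w @ z) y = pos w y" "pos (w @ z) (partner y) = pos w (partner y)"
        using forward crossing_word_partner[OF w] by (simp_all add: pos_append)
      then show ?thesis using forward face_step_forward[of y w] face_step_forward[of y "w @ z"] by simp
    next
      case (backward y)
      have "pos (w @ z) y = pos w y" "pos (w @ z) (partner y) = pos w (partner y)"
        using backward crossing_word_partner[OF w] by (simp_all add: pos_append)
      then show ?thesis using backward face_step_backward[of y w] face_step_backward[of y "w @ z"] by simp
    next
      case root
      then show ?thesis by (simp add: face_step_root)
    qed (use that in auto)
  qed
  have sub: "orbit ?f ?x \<subseteq> insert ?x (orbit ?g ?x)"
    using face_step_end[of w] agree by (intro orbit_except[of _ ?t]) auto
  have tx: "?t \<in> orbit ?f ?x"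
    using orbit.base[of ?f ?t] face_step_end[of w] same_face_sym[OF w] by simp
  then show "?t \<in> orbit ?g ?x" using sub by auto
  show "(0, False) \<in> orbit ?g ?x" if "closable w"
  proof -
    have "(0, False) \<in> orbit ?f ?x"
      using that tx unfolding closable_def by (rule orbit_trans)
    then show ?thesis using sub self[of ?x] by auto
  qed
qed

section \<open>Spirals\<close>

text \<open>Strands that run outward meet the turns in descending order.\<close>

definition down :: "(nat \<Rightarrow> 'a) \<Rightarrow> nat \<Rightarrow> nat \<Rightarrow> 'a list" where
  "down f a b = map f (rev [a..<b])"

lemma down_split: "a \<le> i \<Longrightarrow> i < b \<Longrightarrow> down f a b = down f (Suc i) b @ f i # down f a i"
  using upt_add_eq_append[of a i "b - i"] upt_conv_Cons[of i b] by (simp add: down_def)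

lemma down_empty [simp]: "down f a a = []"
  by (simp add: down_def)

lemma down_last: "a < b \<Longrightarrow> down f a b = down f (Suc a) b @ [f a]"
  by (simp add: down_split[of a a b])

lemma down_Suc: "a \<le> b \<Longrightarrow> down f a (Suc b) = f b # down f a b"
  by (simp add: down_split[of a b "Suc b"] del: upt_Suc) 

lemma length_down [simp]: "length (down f a b) = b - a"
  by (simp add: down_def)

lemma set_down [simp]: "set (down f a b) = f ` {a..<b}"
  by (simp add: down_def)

text \<open>A spiral starts with two parallel radial strands, inward with passages \<open>q\<close> and outward with
  passages \<open>out\<close>, and then winds counterclockwise towards the center, crossing both strands once per
  turn.  Finally the arc can run from the center back outward, crossing all the turns at \<open>v\<close>.\<close>

locale spiral =
  fixes q out v :: "nat \<Rightarrow> passage" and L :: nat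
  assumes rtl_q: "\<not> rtl (q i)" and rtl_out: "rtl (out i)" and rtl_v: "rtl (v i)"
    and label_q: "label (q i) = L + 3 * i" and label_out: "label (out i) = L + 3 * i + 1"
    and label_v: "label (v i) = L + 3 * i + 2"
begin

definition turns_upto :: "nat \<Rightarrow> passage list" where
  "turns_upto m = concat (map (\<lambda>i. [partner (q i), partner (out i)]) [0..<m])"

text \<open>These turns have already been crossed by the returning strand, which meets each of them
  just before the two radial strands do.\<close>

definition crossed_turns :: "nat \<Rightarrow> nat \<Rightarrow> passage list" where
  "crossed_turns s m = concat (map (\<lambda>i. [partner (v i), partner (q i), partner (out i)]) [s..<m])"

definition strands :: "nat \<Rightarrow> passage list" where
  "strands m = map q [0..<m] @ down out 0 m"

definition arc_spiral :: "nat \<Rightarrow> passage list" where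
  "arc_spiral m = strands m @ turns_upto m"

definition closed_spiral :: "nat \<Rightarrow> passage list" where
  "closed_spiral m = strands m @ crossed_turns 0 m @ down v 0 m"

lemma turns_upto_0 [simp]: "turns_upto 0 = []"
  and turns_upto_Suc: "turns_upto (Suc m) = turns_upto m @ [partner (q m), partner (out m)]"
  by (simp_all add: turns_upto_def)

lemma length_turns_upto [simp]: "length (turns_upto m) = 2 * m"
  by (induction m) (simp_all add: turns_upto_Suc)

lemma set_turns_upto: "set (turns_upto m) = (\<Union>i<m. {partner (q i), partner (out i)})"
  by (auto simp: turns_upto_def)

lemma set_crossed_turns: "set (crossed_turns s m) = (\<Union>i\<in>{s..<m}. {partner (v i), partner (q i), partner (out i)})"
  by (auto simp: crossed_turns_def)

lemma crossed_turns_empty [simp]: "crossed_turns m m = []"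
  and crossed_turns_step: "s < m \<Longrightarrow> crossed_turns s m = [partner (v s), partner (q s), partner (out s)] @ crossed_turns (Suc s) m"
  by (simp_all add: crossed_turns_def upt_conv_Cons)

context
  fixes w :: "passage list"
  assumes w: "planar w" and fresh: "\<forall>y\<in>set w. label y < L"
begin

text \<open>The tip has to cross the bend, the edge joining the inward to the outward strand; a face
  walk around the innermost region shows that it can.\<close>

lemma planar_spiral_step1:
  assumes pl: "planar (w @ arc_spiral m)"
  shows "planar (w @ map q [0..<Suc m] @ down out 0 m @ turns_upto m @ [partner (q m)])"
proof (cases m)
  case 0
  \<comment> \<open>Before the first turn the bend is the last edge itself, and crossing it is a
    curl.\<close>
  have "label (q 0) \<notin> label ` set w" using fresh label_q[of 0] by auto
  then show ?thesis
    using planar_curl[of w "partner (q 0)"] w rtl_q 0 by simp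
next
  case (Suc k)
  define W where "W = w @ arc_spiral m"
  let ?f = "face_step W"
  have cw: "crossing_word W" using planar_crossing_word[OF pl] unfolding W_def .
  have W: "W = w @ map q [0..<k] @ [q k, out k] @ down out 0 k @ turns_upto k @ [partner (q k), partner (out k)]"
    by (simp add: W_def arc_spiral_def strands_def Suc down_Suc turns_upto_Suc)
  note d = crossing_word_distinct[OF cw, unfolded W]
  have pos_q: "pos W (q k) = length w + k" and pos_out: "pos W (out k) = length w + Suc k"
    and pos_Q: "pos W (partner (q k)) = length w + 4 * k + 2"
    and pos_O: "Suc (pos W (partner (out k))) = length W"
    using d unfolding W by (auto simp: pos_append)
  have in_W: "q k \<in> set W" "out k \<in> set W" by (simp_all add: W)
  have 1: "?f (length w + m, False) = (pos W (partner (q k)), False)"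
    using face_step_backward[OF in_W(1)] rtl_q pos_q Suc by simp
  have 2: "?f (Suc (pos W (out k)), False) = (length W, True)"
    using face_step_backward[OF in_W(2)] rtl_out pos_O by simp
  \<comment> \<open>For \<open>k = 0\<close> the edge before \<open>partner (q k)\<close> is the
    edge after \<open>out k\<close>; otherwise a right turn at \<open>partner (out j)\<close> leads
    from one to the other.\<close>
  have "(length W, True) \<in> orbit ?f (length w + m, False)"
  proof (cases k)
    case 0
    then have "?f (length w + m, False) = (Suc (pos W (out k)), False)"
      using 1 pos_Q pos_out by simp
    then show ?thesis using 2 by (metis orbit.intros)
  next
    case (Suc j)
    have W': "W = w @ map q [0..<Suc k] @ [out k, out j] @ down out 0 j @ turns_upto j @ [partner (q j), partner (out j), partner (q k), partner (out k)]"
      by (simp add: W Suc down_Suc turns_upto_Suc)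
    note d = crossing_word_distinct[OF cw, unfolded W']
    have pos: "pos W (out j) = Suc (pos W (out k))" "pos W (partner (q k)) = Suc (pos W (partner (out j)))"
      using d unfolding W' by (auto simp: pos_append)
    have "partner (out j) \<in> set W" by (simp add: W')
    then have "?f (pos W (partner (q k)), False) = (Suc (pos W (out k)), False)"
      using face_step_backward[of "partner (out j)" W] rtl_out pos by simp
    then show ?thesis using 1 2 by (metis orbit.intros)
  qed
  then have "(length w + m, False) \<in> orbit ?f (length W, True)"
    by (rule same_face_sym[OF cw])
  moreover have "label (partner (q m)) \<notin> label ` set (w @ arc_spiral m)"
    using fresh label_q label_out by (auto simp: arc_spiral_def strands_def set_turns_upto) (metis | presburger)+
  ultimately show ?thesis
    using planar_grow[of "w @ map q [0..<m]" "down out 0 m @ turns_upto m" "partner (q m)"] pl rtl_q Suc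
    by (simp add: W_def arc_spiral_def strands_def down_Suc)
qed

text \<open>Having crossed \<open>q m\<close>, the tip faces the rest of the bend, now the edge from
  \<open>q m\<close> to the outward strand.\<close>

lemma planar_spiral_step2:
  assumes pl: "planar (w @ map q [0..<Suc m] @ down out 0 m @ turns_upto m @ [partner (q m)])"
  shows "planar (w @ arc_spiral (Suc m))"
proof -
  define W where "W = w @ map q [0..<Suc m] @ down out 0 m @ turns_upto m @ [partner (q m)]"
  let ?f = "face_step W"
  have cw: "crossing_word W" using planar_crossing_word[OF pl] unfolding W_def .
  note d = crossing_word_distinct[OF cw, unfolded W_def]
  have pos_q: "pos W (q m) = length w + m" and pos_Q: "Suc (pos W (partner (q m))) = length W"
    using d unfolding W_def by (auto simp: pos_append)
  have in_W: "q m \<in> set W" "partner (q m) \<in> set W" by (simp_all add: W_def)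
  have 1: "?f (pos W (q m), True) = (length W, True)"
    using face_step_forward[OF in_W(1)] rtl_q pos_Q by simp
  \<comment> \<open>For \<open>m = 0\<close> the walk from the curl runs around the whole old word,
    hence \<open>prefix_face\<close>; later it stays inside the spiral.\<close>
  have "(length W, True) \<in> orbit ?f (length w + Suc m, True)"
  proof (cases m)
    case 0
    have "pos W (partner (q m)) = length w + Suc m" using d unfolding W_def by (auto simp: pos_append 0)
    then have "?f (length w + Suc m, True) = (length w, False)"
      using face_step_forward[OF in_W(2)] rtl_q pos_q 0 by simp
    moreover have "(length w, True) \<in> orbit ?f (length w, False)"
      using prefix_face(1)[of w "map q [0..<Suc m] @ down out 0 m @ turns_upto m @ [partner (q m)]"]
        planar_crossing_word[OF w] cw by (simp add: W_def)
    moreover have "(pos W (q m), True) = (length w, True)" using pos_q 0 by simp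
    ultimately show ?thesis using 1 by (metis orbit.step orbit_subset)
  next
    case (Suc k)
    have W': "W = w @ map q [0..<k] @ [q k, q m, out k] @ down out 0 k @ turns_upto k @ [partner (q k), partner (out k), partner (q m)]"
      by (simp add: W_def Suc down_Suc turns_upto_Suc)
    note d = crossing_word_distinct[OF cw, unfolded W']
    have pos: "pos W (out k) = length w + Suc m" "pos W (partner (out k)) = Suc (pos W (partner (q k)))"
        "pos W (q m) = Suc (pos W (q k))"
      using d unfolding W' by (auto simp: pos_append Suc)
    have in_W': "out k \<in> set W" "partner (q k) \<in> set W" by (simp_all add: W')
    have "?f (length w + Suc m, True) = (Suc (pos W (partner (q k))), False)"
      using face_step_forward[OF in_W'(1)] rtl_out pos by simp
    moreover have "?f (Suc (pos W (partner (q k))), False) = (pos W (q m), True)"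
      using face_step_backward[OF in_W'(2)] rtl_q pos by simp
    ultimately show ?thesis using 1 by (metis orbit.intros)
  qed
  then have "(length w + Suc m, True) \<in> orbit ?f (length W, True)"
    by (rule same_face_sym[OF cw])
  moreover have "label (partner (out m)) \<notin> label ` set W"
    using fresh label_q label_out by (auto simp: W_def set_turns_upto)
  ultimately show ?thesis
    using planar_grow[of "w @ map q [0..<Suc m]" "down out 0 m @ turns_upto m @ [partner (q m)]" "partner (out m)"]
      pl rtl_out
    by (simp add: W_def arc_spiral_def strands_def down_Suc turns_upto_Suc)
qed

lemma planar_arc_spiral: "planar (w @ arc_spiral m)"
proof (induction m)
  case 0
  then show ?case using w by (simp add: arc_spiral_def strands_def)
next
  case (Suc m)
  then show ?case by (intro planar_spiral_step2 planar_spiral_step1)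
qed

section \<open>Bringing the inner end back outward\<close>

text \<open>The stages of a downward induction: the returning strand has crossed the turns from
  \<open>m - 1\<close> down to \<open>s\<close>.\<close>

definition partly_closed :: "nat \<Rightarrow> nat \<Rightarrow> passage list" where
  "partly_closed s m = w @ strands m @ turns_upto s @ crossed_turns s m @ down v s m"

lemma planar_partly_closed:
  assumes "s \<le> m"
  shows "planar (partly_closed s m)"
  using assms
proof (induction rule: inc_induct)
  case base
  then show ?case using planar_arc_spiral[of m] by (simp add: partly_closed_def arc_spiral_def)
next
  case (step s)
  define W where "W = partly_closed (Suc s) m"
  \<comment> \<open>\<open>?e\<close> is the edge of turn \<open>s\<close> that ends at its passage
    through the \<open>q\<close> strand.\<close>
  let ?f = "face_step W" and ?e = "length w + 2 * m + 2 * s"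
  let ?u = "w @ strands m @ turns_upto s"
  let ?v = "[partner (q s), partner (out s)] @ crossed_turns (Suc s) m @ down v (Suc s) m"
  have cw: "crossing_word W" using planar_crossing_word[OF step.IH] unfolding W_def .
  have W: "W = w @ map q [0..<m] @ down out (Suc s) m @ out s # down out 0 s @ turns_upto s @
      [partner (q s), partner (out s)] @ crossed_turns (Suc s) m @ down v (Suc s) m"
    using step.hyps by (simp add: W_def partly_closed_def strands_def down_split[of 0 s m] turns_upto_Suc)
  note d = crossing_word_distinct[OF cw, unfolded W]
  have in_W: "out s \<in> set W" by (simp add: W)
  have "?f (Suc (pos W (out s)), False) = (Suc (pos W (partner (out s))), True)"
    using face_step_backward[OF in_W] rtl_out by simp
  moreover have "(length W, True) = (Suc (pos W (partner (out s))), True) \<or>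
      ?f (Suc (pos W (partner (out s))), True) = (length W, True)"
  proof (cases "Suc s = m")
    case True
    have "Suc (pos W (partner (out s))) = length W"
      using d unfolding W by (auto simp: pos_append True)
    then show ?thesis by simp
  next
    case False
    then have s: "Suc s < m" using step.hyps by simp
    have W': "W = w @ strands m @ turns_upto s @
        [partner (q s), partner (out s), partner (v (Suc s)), partner (q (Suc s)), partner (out (Suc s))] @
        crossed_turns (Suc (Suc s)) m @ down v (Suc (Suc s)) m @ [v (Suc s)]"
      using s step.hyps
      by (simp add: W_def partly_closed_def turns_upto_Suc crossed_turns_step down_last)
    note d = crossing_word_distinct[OF cw, unfolded W']
    have pos: "pos W (partner (v (Suc s))) = Suc (pos W (partner (out s)))" "Suc (pos W (v (Suc s))) = length W"
      using d unfolding W' by (auto simp: pos_append)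
    have "partner (v (Suc s)) \<in> set W" by (simp add: W')
    then show ?thesis using face_step_forward[of "partner (v (Suc s))" W] rtl_v pos by simp
  qed
  ultimately have out: "(length W, True) \<in> orbit ?f (Suc (pos W (out s)), False)"
    by (metis orbit.intros)
  \<comment> \<open>Turn 0 begins where the outward strand ends, so there \<open>?e\<close> is the
    edge after \<open>out 0\<close>; otherwise a right turn at \<open>partner (out k)\<close> leads
    to the edge after \<open>out s\<close>.\<close>
  have "(length W, True) \<in> orbit ?f (?e, False)"
  proof (cases s)
    case 0
    have "pos W (out s) = length w + 2 * m - 1"
      using d step.hyps unfolding W by (auto simp: pos_append 0)
    then show ?thesis using out 0 step.hyps by simp
  next
    case (Suc k)
    have W': "W = w @ map q [0..<m] @ down out (Suc s) m @ [out s, out k] @ down out 0 k @ turns_upto k @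
      [partner (q k), partner (out k), partner (q s), partner (out s)] @ crossed_turns (Suc s) m @ down v (Suc s) m"
      by (simp add: W Suc down_Suc turns_upto_Suc)
    note d = crossing_word_distinct[OF cw, unfolded W']
    have pos: "pos W (out k) = Suc (pos W (out s))" "Suc (pos W (partner (out k))) = ?e"
      using d step.hyps unfolding W' by (auto simp: pos_append Suc)
    have "partner (out k) \<in> set W" by (simp add: W')
    then have "?f (?e, False) = (Suc (pos W (out s)), False)"
      using face_step_backward[of "partner (out k)" W] rtl_out pos by simp
    then show ?thesis using out orbit_subset by metis
  qed
  then have "(?e, False) \<in> orbit ?f (length W, True)"
    by (rule same_face_sym[OF cw])
  moreover have "label (v s) \<notin> label ` set W"
    using fresh label_q label_out label_v unfolding W
    by (auto simp: set_turns_upto set_crossed_turns) (metis | presburger)+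
  moreover have "?u @ ?v = W" "length ?u = ?e"
    using step.hyps by (simp_all add: W_def partly_closed_def turns_upto_Suc strands_def)
  moreover have "?u @ [partner (v s)] @ ?v @ [v s] = partly_closed s m"
    using step.hyps by (simp add: partly_closed_def crossed_turns_step down_last)
  ultimately show ?case
    using planar_grow[of ?u ?v "v s"] step.IH rtl_v unfolding W_def by (simp only: not_True_eq_False) simp
qed

lemma planar_closed_spiral: "planar (w @ closed_spiral m)"
  using planar_partly_closed[of 0 m] by (simp add: partly_closed_def closed_spiral_def)

text \<open>Having crossed turn 0, the tip shares its face with the edge on which the spiral leaves
  \<open>w\<close>; from there the walk around \<open>w\<close> reaches the root.\<close>

lemma closable_closed_spiral:
  assumes "closable w"
  shows "closable (w @ closed_spiral m)"
proof (cases m)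
  case 0
  then show ?thesis using assms by (simp add: closed_spiral_def strands_def)
next
  case (Suc k)
  define W where "W = w @ closed_spiral m"
  let ?f = "face_step W"
  have cw: "crossing_word W" using planar_crossing_word[OF planar_closed_spiral] unfolding W_def .
  have W: "W = w @ q 0 # map q [1..<m] @ down out 0 m @
      [partner (v 0), partner (q 0), partner (out 0)] @ crossed_turns 1 m @ down v 1 m @ [v 0]"
    by (simp add: W_def closed_spiral_def strands_def crossed_turns_step down_last Suc upt_conv_Cons del: upt_Suc)
  note d = crossing_word_distinct[OF cw, unfolded W]
  have pos: "pos W (q 0) = length w" "pos W (partner (q 0)) = Suc (pos W (partner (v 0)))" "Suc (pos W (v 0)) = length W"
    using d unfolding W by (auto simp: pos_append)
  have in_W: "partner (q 0) \<in> set W" "v 0 \<in> set W" by (simp_all add: W)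
  have "?f (length W, True) = (length W, False)" by (rule face_step_end)
  moreover have "?f (length W, False) = (pos W (partner (q 0)), True)"
    using face_step_backward[OF in_W(2)] rtl_v pos by simp
  moreover have "?f (pos W (partner (q 0)), True) = (length w, False)"
    using face_step_forward[OF in_W(1)] rtl_q pos by simp
  ultimately have "(length w, False) \<in> orbit ?f (length W, True)"
    by (metis orbit.intros)
  moreover have "(0, False) \<in> orbit ?f (length w, False)"
    using prefix_face(2)[of w "closed_spiral m"] planar_crossing_word[OF w] cw assms by (simp add: W_def)
  ultimately show ?thesis
    unfolding closable_def W_def[symmetric] by (rule orbit_trans[rotated])
qed

end

end

section \<open>The surface of a word\<close>

text \<open>Faces are the orbits of the rotation after \<open>flip\<close>, so the rotation is
  \<open>face_step w\<close> after \<open>flip\<close>. The transposition joins the two end vertices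
  of valency one into a basepoint of valency two.\<close>

definition word_rot :: "bool \<Rightarrow> passage list \<Rightarrow> dart \<Rightarrow> dart" where
  "word_rot c w d = (if d \<in> word_darts w
     then face_step w (flip (if c then transpose (0, True) (length w, False) d else d)) else d)"

text \<open>The arc itself cut at its crossings for \<open>\<not> c\<close>; for \<open>c\<close> its two ends are glued together.\<close>

definition word_surface :: "bool \<Rightarrow> passage list \<Rightarrow> surface" where
  "word_surface c w = \<lparr>edges = {..length w}, rot = word_rot c w\<rparr>"

definition word_walk :: "passage list \<Rightarrow> dart list" where
  "word_walk w = map (\<lambda>k. (k, True)) [0..<Suc (length w)]"

lemma darts_word_surface [simp]: "darts (word_surface c w) = word_darts w"
  by (simp add: darts_def word_surface_def word_darts_def)

lemma rot_word_surface [simp]: "rot (word_surface c w) = word_rot c w"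
  by (simp add: word_surface_def)

definition crossing_darts :: "passage list \<Rightarrow> passage \<Rightarrow> dart set" where
  "crossing_darts w x = {(Suc (pos w x), True), (Suc (pos w (partner x)), True),
     (pos w x, False), (pos w (partner x), False)}"

lemma crossing_darts_partner: "crossing_darts w (partner x) = crossing_darts w x"
  by (auto simp: crossing_darts_def)

lemma orbit_four_cycle:
  assumes "f a = b" "f b = c" "f c = d" "f d = a"
  shows "orbit f a = {a, b, c, d}"
proof
  show "orbit f a \<subseteq> {a, b, c, d}"
  proof
    fix y assume "y \<in> orbit f a"
    then show "y \<in> {a, b, c, d}" by induction (use assms in auto)
  qed
  have "b \<in> orbit f a" using orbit.base[of f a] unfolding assms(1) .
  moreover from orbit.step[OF this] have "c \<in> orbit f a" unfolding assms(2) .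
  moreover from orbit.step[OF this] have "d \<in> orbit f a" unfolding assms(3) .
  moreover from orbit.step[OF this] have "a \<in> orbit f a" unfolding assms(4) .
  ultimately show "{a, b, c, d} \<subseteq> orbit f a" by blast
qed

context
  fixes c :: bool and w :: "passage list"
  assumes cw: "crossing_word w"
begin

lemmas distinct_w = crossing_word_distinct[OF cw]
  and partner_w = crossing_word_partner[OF cw]

lemma word_rot_permutes: "word_rot c w permutes word_darts w"
proof -
  let ?t = "if c then transpose (0, True) (length w, False) else id"
  have t: "?t permutes word_darts w"
    by (auto simp: word_darts_def intro: permutes_swap_id permutes_id)
  note f = face_step_permutes[OF cw]
  have eq: "word_rot c w d = face_step w (flip (?t d))" if "d \<in> word_darts w" for d
    using that by (auto simp: word_rot_def)
  have "inj_on (word_rot c w) (word_darts w)"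
  proof (rule inj_onI)
    fix d e assume d: "d \<in> word_darts w" and e: "e \<in> word_darts w" and "word_rot c w d = word_rot c w e"
    then have "face_step w (flip (?t d)) = face_step w (flip (?t e))" by (simp only: eq)
    then have "flip (?t d) = flip (?t e)" using permutes_inj[OF f] by (simp only: inj_eq)
    then have "?t d = ?t e" by (metis flip_flip)
    then show "d = e" using permutes_inj[OF t] by (simp only: inj_eq)
  qed
  moreover have "word_rot c w d \<in> word_darts w" if "d \<in> word_darts w" for d
    using that permutes_in_image[OF f] permutes_in_image[OF t] eq by auto
  ultimately have "bij_betw (word_rot c w) (word_darts w) (word_darts w)"
    by (simp add: bij_betw_def endo_inj_surj image_subset_iff)
  then show ?thesis by (rule bij_imp_permutes) (simp add: word_rot_def)
qed

lemma word_rot_crossing: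
  assumes x: "x \<in> set w"
  shows "word_rot c w (Suc (pos w x), True) =
      (if rtl x then (Suc (pos w (partner x)), True) else (pos w (partner x), False))"
    and "word_rot c w (pos w x, False) =
      (if rtl x then (pos w (partner x), False) else (Suc (pos w (partner x)), True))"
  using pos_less[OF x] face_step_forward[OF x] face_step_backward[OF x]
  by (auto simp: word_rot_def word_darts_def transpose_def)

text \<open>Around a crossing the darts of the two strands alternate, so two rotation steps lead
  straight across; the surface is connected along the arc.\<close>

lemma word_rot_opposite:
  assumes x: "x \<in> set w"
  shows "word_rot c w (word_rot c w (pos w x, False)) = (Suc (pos w x), True)"
    and "word_rot c w (word_rot c w (Suc (pos w x), True)) = (pos w x, False)"
  using word_rot_crossing[OF x] word_rot_crossing[OF partner_w[OF x]] by auto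

lemma vertex_crossing:
  assumes x: "x \<in> set w"
  shows "vertex (word_surface c w) (Suc (pos w x), True) = crossing_darts w x"
    and "vertex (word_surface c w) (pos w x, False) = crossing_darts w x"
proof -
  let ?r = "word_rot c w" and ?i = "pos w x" and ?j = "pos w (partner x)"
  note r = word_rot_crossing[OF x] word_rot_crossing[OF partner_w[OF x]]
  show "vertex (word_surface c w) (Suc ?i, True) = crossing_darts w x"
  proof (cases "rtl x")
    case True
    then show ?thesis
      using orbit_four_cycle[of ?r "(Suc ?i, True)" "(Suc ?j, True)" "(?i, False)" "(?j, False)"] r
      by (auto simp: vertex_def crossing_darts_def)
  next
    case False
    then show ?thesis
      using orbit_four_cycle[of ?r "(Suc ?i, True)" "(?j, False)" "(?i, False)" "(Suc ?j, True)"] r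
      by (auto simp: vertex_def crossing_darts_def)
  qed
  then have "(?i, False) \<in> orbit ?r (Suc ?i, True)"
    by (simp add: vertex_def crossing_darts_def)
  then show "vertex (word_surface c w) (?i, False) = crossing_darts w x"
    using orbit_permutes_eq[OF word_rot_permutes finite_word_darts, of "(?i, False)" "(Suc ?i, True)"]
      \<open>vertex (word_surface c w) (Suc ?i, True) = crossing_darts w x\<close>
    unfolding vertex_def rot_word_surface by simp
qed

lemma card_crossing_darts:
  assumes "x \<in> set w"
  shows "card (crossing_darts w x) = 4"
proof -
  have "pos w x \<noteq> pos w (partner x)"
    using assms partner_w[OF assms] by (metis partner_neq(1) pos_inj)
  then show ?thesis by (simp add: crossing_darts_def)
qed

lemma crossing_darts_eq_iff:
  assumes "x \<in> set w" "y \<in> set w"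
  shows "crossing_darts w x = crossing_darts w y \<longleftrightarrow> label x = label y"
proof
  assume eq: "crossing_darts w x = crossing_darts w y"
  have "(Suc (pos w x), True) \<in> crossing_darts w x" by (simp add: crossing_darts_def)
  then have "pos w x = pos w y \<or> pos w x = pos w (partner y)"
    unfolding eq by (simp add: crossing_darts_def)
  then have "x = y \<or> x = partner y"
    using assms partner_w[OF assms(2)] pos_inj by metis
  then show "label x = label y" by auto
next
  assume "label x = label y"
  then show "crossing_darts w x = crossing_darts w y"
    using crossing_word_label[OF cw assms] crossing_darts_partner by metis
qed

lemma vertex_ends:
  "vertex (word_surface c w) (0, True) = (if c then {(0, True), (length w, False)} else {(0, True)})"
  "vertex (word_surface c w) (length w, False) = (if c then {(0, True), (length w, False)} else {(length w, False)})"
proof -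
  let ?r = "word_rot c w" and ?a = "(0, True) :: dart" and ?b = "(length w, False) :: dart"
  have r: "?r ?a = (if c then ?b else ?a)" "?r ?b = (if c then ?a else ?b)"
    by (auto simp: word_rot_def word_darts_def transpose_def face_step_root face_step_end)
  have "orbit ?r ?a = {?a, ?b} \<and> orbit ?r ?b = {?a, ?b}" if c
    using orbit_four_cycle[of ?r ?a ?b ?a ?b] orbit_four_cycle[of ?r ?b ?a ?b ?a] r that
    by (simp add: insert_commute)
  moreover have "orbit ?r ?a = {?a} \<and> orbit ?r ?b = {?b}" if "\<not> c"
    using r that by (simp add: orbit_eq_singleton_iff)
  ultimately show "vertex (word_surface c w) ?a = (if c then {?a, ?b} else {?a})"
      "vertex (word_surface c w) ?b = (if c then {?a, ?b} else {?b})"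
    unfolding vertex_def rot_word_surface by presburger+
qed

lemma closed_surface_word_surface: "closed_surface (word_surface c w)"
proof -
  define R where "R = (\<lambda>x y. y = word_rot c w x \<or> y = flip x)"
  have flip: "R\<^sup>*\<^sup>* d (flip d)" and one: "R\<^sup>*\<^sup>* d (word_rot c w d)" for d
    by (rule r_into_rtranclp, simp add: R_def)+
  have two: "R\<^sup>*\<^sup>* d (word_rot c w (word_rot c w d))" for d
    by (rule rtranclp_trans[OF one one])
  have step: "R\<^sup>*\<^sup>* (k, True) (Suc k, True)" "R\<^sup>*\<^sup>* (Suc k, True) (k, True)" if "k < length w" for k
  proof -
    have x: "w ! k \<in> set w" "pos w (w ! k) = k"
      using that distinct_w by (simp_all add: pos_nth)
    show "R\<^sup>*\<^sup>* (k, True) (Suc k, True)"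
      using rtranclp_trans[OF flip[of "(k, True)"]] two[of "(k, False)"] word_rot_opposite(1)[OF x(1)]
      by (simp add: x(2))
    show "R\<^sup>*\<^sup>* (Suc k, True) (k, True)"
      using rtranclp_trans[OF two[of "(Suc k, True)"]] flip[of "(k, False)"] word_rot_opposite(2)[OF x(1)]
      by (simp add: x(2))
  qed
  have forth: "R\<^sup>*\<^sup>* (0, True) (k, True)" and backw: "R\<^sup>*\<^sup>* (k, True) (0, True)" if "k \<le> length w" for k
    using that
  proof (induction k)
    case (Suc k)
    {
      case 1
      then show ?case using step(1)[of k] Suc.IH(1) by (simp add: rtranclp_trans)
    next
      case 2
      then show ?case using rtranclp_trans[OF step(2)[of k]] Suc.IH(2) by simp
    }
  qed simp_all
  have flip': "R\<^sup>*\<^sup>* (k, True) (k, b)" "R\<^sup>*\<^sup>* (k, b) (k, True)" for k b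
    using flip[of "(k, True)"] flip[of "(k, False)"] by (cases b; simp)+
  have "R\<^sup>*\<^sup>* d d'" if "d \<in> word_darts w" "d' \<in> word_darts w" for d d'
  proof -
    obtain k b k' b' where d: "d = (k, b)" "d' = (k', b')" "k \<le> length w" "k' \<le> length w"
      using \<open>d \<in> word_darts w\<close> \<open>d' \<in> word_darts w\<close> by (auto simp: word_darts_def)
    show ?thesis
      unfolding d(1,2)
      by (rule rtranclp_trans[OF rtranclp_trans[OF flip'(2) backw[OF d(3)]] rtranclp_trans[OF forth[OF d(4)] flip'(1)]])
  qed
  then show ?thesis
    using word_rot_permutes
    by (simp add: closed_surface_def R_def) (auto simp: word_surface_def)
qed

lemma nth_word_walk: "k \<le> length w \<Longrightarrow> word_walk w ! k = (k, True)"
  unfolding word_walk_def by (simp del: upt_Suc)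

lemma start_end_word_walk:
  "start_vertex (word_surface c w) (word_walk w) = vertex (word_surface c w) (0, True)"
  "end_vertex (word_surface c w) (word_walk w) = vertex (word_surface c w) (length w, False)"
proof -
  have "length (word_walk w) = Suc (length w)" by (simp add: word_walk_def)
  moreover from this have "word_walk w \<noteq> []" by auto
  ultimately have "hd (word_walk w) = (0, True)" "last (word_walk w) = (length w, True)"
    by (simp_all add: hd_conv_nth last_conv_nth nth_word_walk)
  then show "start_vertex (word_surface c w) (word_walk w) = vertex (word_surface c w) (0, True)"
    "end_vertex (word_surface c w) (word_walk w) = vertex (word_surface c w) (length w, False)"
    by (simp_all add: start_vertex_def end_vertex_def)
qed

lemma diagram_on_word_surface: "diagram_on (word_surface c w) (word_walk w) w"
proof -
  let ?S = "word_surface c w" and ?ds = "word_walk w" and ?n = "length w"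
  have v: "vertex ?S (?ds ! Suc k) = crossing_darts w (w ! k)" "vertex ?S (flip (?ds ! k)) = crossing_darts w (w ! k)"
    if "k < ?n" for k
    using vertex_crossing[of "w ! k"] that distinct_w by (simp_all add: nth_word_walk pos_nth)
  have not_end: "(0, True) \<notin> crossing_darts w x" "(?n, False) \<notin> crossing_darts w x" if "x \<in> set w" for x
    using pos_less[OF that] pos_less[OF partner_w[OF that]] by (auto simp: crossing_darts_def)
  have "crossing_darts w x \<noteq> start_vertex ?S ?ds" "crossing_darts w x \<noteq> end_vertex ?S ?ds" if "x \<in> set w" for x
    unfolding start_end_word_walk vertex_ends using not_end[OF that] by (auto split: if_splits)
  moreover have "ccw ?S (?ds ! Suc k) (?ds ! Suc l) (flip (?ds ! k)) (flip (?ds ! l))"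
    if kl: "k < ?n" "l < ?n" and p: "w ! l = partner (w ! k)" and r: "rtl (w ! k)" for k l
  proof -
    have x: "w ! k \<in> set w" "w ! l \<in> set w" using kl by auto
    have pos: "pos w (w ! k) = k" "pos w (w ! l) = l" using kl distinct_w by (simp_all add: pos_nth)
    have rot: "word_rot c w (Suc k, True) = (Suc l, True)" "word_rot c w (Suc l, True) = (k, False)"
        "word_rot c w (k, False) = (l, False)"
      using word_rot_crossing[OF x(1)] word_rot_crossing[OF x(2)] pos p r by auto
    have "card (vertex ?S (Suc k, True)) = 4"
      using vertex_crossing(1)[OF x(1)] card_crossing_darts[OF x(1)] pos by simp
    then show ?thesis
      unfolding ccw_def using rot kl
      by (intro exI[of _ 1] exI[of _ 2] exI[of _ 3]) (simp add: nth_word_walk numeral_2_eq_2 numeral_3_eq_3)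
  qed
  moreover have "length ?ds = Suc ?n" "set ?ds \<subseteq> word_darts w" "distinct (map fst ?ds)"
    by (auto simp: word_walk_def word_darts_def comp_def simp del: upt_Suc)
  ultimately show ?thesis
    unfolding diagram_on_def darts_word_surface
    by (intro conjI allI impI; (elim conjE)?) (simp_all add: v crossing_darts_eq_iff)
qed

lemma closed_diagram_on_word_surface:
  "c \<Longrightarrow> closed_diagram_on (word_surface c w) (word_walk w) w"
  unfolding closed_diagram_on_def start_end_word_walk vertex_ends
  using diagram_on_word_surface by simp

lemma start_neq_end_word_surface:
  "\<not> c \<Longrightarrow> start_vertex (word_surface c w) (word_walk w) \<noteq> end_vertex (word_surface c w) (word_walk w)"
  unfolding start_end_word_walk vertex_ends by simp

text \<open>Each crossing owns four darts, and the crossings partition all darts except the two that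
  leave the ends.\<close>

lemma card_vertices_word_surface:
  "2 * card (vertex (word_surface c w) ` word_darts w) = length w + (if c then 2 else 4)"
proof -
  let ?V = "vertex (word_surface c w)" and ?n = "length w"
  let ?X = "crossing_darts w ` set w" and ?E = "{?V (0, True), ?V (?n, False)}"
  have image: "?V ` word_darts w = ?X \<union> ?E"
  proof (intro equalityI subsetI)
    fix y assume "y \<in> ?V ` word_darts w"
    then obtain d where d: "d \<in> word_darts w" "y = ?V d" by blast
    show "y \<in> ?X \<union> ?E"
    proof (cases "\<exists>k<?n. d = (Suc k, True) \<or> d = (k, False)")
      case True
      then obtain x where "x \<in> set w" "d = (Suc (pos w x), True) \<or> d = (pos w x, False)"
        using distinct_w by (metis nth_mem pos_nth)
      then show ?thesis using vertex_crossing d by auto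
    next
      case False
      then have "d = (0, True) \<or> d = (?n, False)"
        using d(1) spec[of "\<lambda>k. \<not> (k < ?n \<and> (d = (Suc k, True) \<or> d = (k, False)))" "fst d"]
          spec[of "\<lambda>k. \<not> (k < ?n \<and> (d = (Suc k, True) \<or> d = (k, False)))" "fst d - 1"]
        by (cases d; cases "fst d"; cases "snd d") (auto simp: word_darts_def)
      then show ?thesis using d by auto
    qed
  next
    fix y assume "y \<in> ?X \<union> ?E"
    then consider x where "x \<in> set w" "y = crossing_darts w x" | "y = ?V (0, True)" | "y = ?V (?n, False)" by auto
    then show "y \<in> ?V ` word_darts w"
    proof cases
      case 1
      then show ?thesis
        using vertex_crossing(2)[OF 1(1)] pos_less[OF 1(1)]
        by (auto simp: word_darts_def intro!: image_eqI[of _ _ "(pos w x, False)"])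
    qed (auto simp: word_darts_def)
  qed
  have disj: "?X \<inter> ?E = {}"
  proof -
    have "(0, True) \<notin> crossing_darts w x" "(?n, False) \<notin> crossing_darts w x" if "x \<in> set w" for x
      using pos_less[OF that] pos_less[OF partner_w[OF that]] by (auto simp: crossing_darts_def)
    then show ?thesis unfolding vertex_ends by (auto split: if_splits)
  qed
  have E: "card ?E = (if c then 1 else 2)"
    unfolding vertex_ends by simp
  have X: "2 * card ?X = ?n"
  proof -
    have U: "\<Union> ?X = {1..?n} \<times> {True} \<union> {..<?n} \<times> {False}"
    proof (intro equalityI subsetI)
      fix d assume "d \<in> \<Union> ?X"
      then show "d \<in> {1..?n} \<times> {True} \<union> {..<?n} \<times> {False}"
        using pos_less partner_w by (fastforce simp: crossing_darts_def Suc_le_eq)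
    next
      fix d assume "d \<in> {1..?n} \<times> {True} \<union> {..<?n} \<times> {False}"
      then obtain k where k: "k < ?n" "d = (Suc k, True) \<or> d = (k, False)"
        by (cases d; cases "fst d") auto
      then have "d \<in> crossing_darts w (w ! k)"
        using distinct_w by (auto simp: crossing_darts_def pos_nth)
      then show "d \<in> \<Union> ?X" using k by auto
    qed
    have "4 * card ?X = card (\<Union> ?X)"
    proof (rule card_partition)
      show "finite (\<Union> ?X)" unfolding U by simp
      show "card y = 4" if "y \<in> ?X" for y using that card_crossing_darts by auto
      show "y \<inter> z = {}" if yz: "y \<in> ?X" "z \<in> ?X" "y \<noteq> z" for y z
      proof (rule ccontr)
        assume "y \<inter> z \<noteq> {}"
        then obtain d where d: "d \<in> y" "d \<in> z" by blast
        obtain x x' where "x \<in> set w" "y = ?V (pos w x, False)" "x' \<in> set w" "z = ?V (pos w x', False)"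
          using yz vertex_crossing(2) by auto
        then show False
          using d yz(3) orbit_permutes_eq[OF word_rot_permutes finite_word_darts]
          unfolding vertex_def rot_word_surface by metis
      qed
    qed simp
    also have "card (\<Union> ?X) = 2 * ?n"
      unfolding U by (subst card_Un_disjoint) auto
    finally show ?thesis by simp
  qed
  have "card (?V ` word_darts w) = card ?X + card ?E"
    unfolding image using disj by (intro card_Un_disjoint) simp_all
  then show ?thesis unfolding E using X by (auto split: if_splits)
qed

text \<open>Gluing the ends costs a vertex, which a face must make up for: the continuations at the
  two ends are exchanged, and since \<open>closable\<close> puts them on one face, this face
  splits.\<close>

lemma surface_of_genus_0_word_surface:
  assumes pl: "planar w" and cl: "c \<Longrightarrow> closable w"
  shows "surface_of_genus 0 (word_surface c w)"
proof -
  let ?f = "face_step w" and ?A = "word_darts w" and ?l = "(length w, True)" and ?o = "(0, False)"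
  define g where "g = (if c then ?f(?l := ?f ?o, ?o := ?f ?l) else ?f)"
  have keys: "?l \<in> ?A" "?o \<in> ?A" "?l \<noteq> ?o" by (simp_all add: word_darts_def)
  note f = face_step_permutes[OF cw]
  have "2 * num_cycles g ?A = length w + (if c then 4 else 2)"
    using pl num_cycles_split[OF f finite_word_darts keys] cl
    by (auto simp: g_def planar_def closable_def)
  moreover have "orbit (word_rot c w \<circ> flip) d = orbit g d" if "d \<in> ?A" for d
  proof (rule orbit_cong0)
    show "d \<in> ?A" by (rule that)
    show "word_rot c w \<circ> flip \<in> ?A \<rightarrow> ?A"
      using permutes_in_image[OF word_rot_permutes] by auto
    show "(word_rot c w \<circ> flip) d = g d" if "d \<in> ?A" for d
      using that by (cases d; cases "snd d") (auto simp: word_rot_def g_def transpose_def word_darts_def)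
  qed
  then have "orbit (word_rot c w \<circ> flip) ` ?A = orbit g ` ?A" by (rule image_cong[OF refl])
  ultimately have F: "2 * card (orbit (word_rot c w \<circ> flip) ` ?A) = length w + (if c then 4 else 2)"
    by (simp add: num_cycles_def)
  have "edges (word_surface c w) = {..length w}" by (simp add: word_surface_def)
  then have "euler_char (word_surface c w) = 2"
    using F card_vertices_word_surface by (auto simp: euler_char_def split: if_splits)
  then show ?thesis by (simp add: surface_of_genus_def closed_surface_word_surface)
qed

end

section \<open>Virtual crossings do not matter\<close>

lemma pos_less_iff:
  "x \<in> set w \<Longrightarrow> pos w x < pos w y \<longleftrightarrow> x \<in> set (takeWhile (\<lambda>z. z \<noteq> y) w)"
  by (induction w) auto

lemma takeWhile_filter_neq:
  "P y \<Longrightarrow> takeWhile (\<lambda>z. z \<noteq> y) (filter P w) = filter P (takeWhile (\<lambda>z. z \<noteq> y) w)"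
  by (induction w) auto

lemma set_real_part: "set (real_part w) = {x\<in>set w. \<not> is_virt x}"
  by (auto simp: real_part_def)

lemma real_part_append: "real_part (u @ v) = real_part u @ real_part v"
  by (simp add: real_part_def)

lemma crossing_word_real_part: "crossing_word w \<Longrightarrow> crossing_word (real_part w)"
  by (auto simp: crossing_word_def set_real_part) (simp add: real_part_def)

lemma sum_list_rho_real_part: "sum_list (map rho (real_part w)) = sum_list (map rho w)"
  by (induction w) (auto simp: real_part_def rho_def)

text \<open>Virtual passages have \<open>rho\<close> 0, so deleting them changes neither the heights
  nor the order of the others.\<close>

lemma word_writhe_real_part:
  assumes "crossing_word w"
  shows "word_writhe a (real_part w) = word_writhe a w"
proof -
  have t: "takeWhile (\<lambda>z. z \<noteq> y) (real_part w) = real_part (takeWhile (\<lambda>z. z \<noteq> y) w)" if "\<not> is_virt y" for y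
    using that by (simp add: real_part_def takeWhile_filter_neq)
  have "hgt (real_part w) y = hgt w y" if "\<not> is_virt y" for y
    by (simp only: hgt_def t[OF that] sum_list_rho_real_part)
  then have "idx (real_part w) y = idx w y" if "\<not> is_virt y" for y
    using that by (simp add: idx_def)
  moreover have "pos (real_part w) x < pos (real_part w) (partner x) \<longleftrightarrow> pos w x < pos w (partner x)"
    if "\<not> is_virt x" "x \<in> set w" for x
    using that t[of "partner x"] pos_less_iff[of x w] pos_less_iff[of x "real_part w"]
    by (simp add: set_real_part)
  then have "firsts a (real_part w) = firsts a w"
    by (auto simp: firsts_def set_real_part)
  ultimately show ?thesis
    unfolding word_writhe_def by (intro sum.cong) (auto simp: crossing_term_def firsts_def)
qed

section \<open>The writhe polynomial and the 2-supporting genus of a knot\<close>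

lemma self_in_knot: "long_virtual_diagram D \<Longrightarrow> D \<in> diagram_equiv `` {D}"
  by (simp add: diagram_equiv_def reflpD[OF reflp_equivclp])

lemma word_writhe_knot:
  assumes "K \<in> long_virtual_knots" "D \<in> K" "D' \<in> K"
  shows "crossing_word D" "word_writhe a D = word_writhe a D'"
proof -
  let ?R = "\<lambda>A B. long_virtual_diagram A \<and> long_virtual_diagram B \<and> reidemeister A B"
  obtain E where E: "K = diagram_equiv `` {E}"
    using assms(1) by (auto simp: long_virtual_knots_def quotient_def)
  have inv: "word_writhe a B = word_writhe a E" if "equivclp ?R E B" for B
    using that
  proof induction
    case (step y z)
    then show ?case
      using word_writhe_reidemeister[of y z] word_writhe_reidemeister[of z y]
      by (metis long_virtual_diagram_def)
  qed simp
  show "crossing_word D" "word_writhe a D = word_writhe a D'"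
    using assms(2,3) inv[of D] inv[of D'] by (auto simp: E diagram_equiv_def long_virtual_diagram_def)
qed

text \<open>The definite description needs existence besides uniqueness: every crossing word has a
  realization on its own \<open>word_surface\<close>, of whatever genus.\<close>

lemma writhe_poly_eq_word_writhe:
  assumes "K \<in> long_virtual_knots" "D \<in> K"
  shows "writhe_poly a K = word_writhe a D"
  unfolding writhe_poly_def
proof (rule the_equality)
  note cw = crossing_word_real_part[OF word_writhe_knot(1)[OF assms assms(2)]]
  have sum: "writhe_sum a S ds (real_part D') = word_writhe a D"
    if "D' \<in> K" "closed_surface S" "closed_diagram_on S ds (real_part D')" for S ds D'
  proof -
    note cw' = word_writhe_knot(1)[OF assms(1) that(1) assms(2)]
    have "writhe_sum a S ds (real_part D') = word_writhe a (real_part D')"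
      using that cw' by (intro writhe_sum_eq_word_writhe crossing_word_real_part) (auto simp: set_real_part)
    then show ?thesis
      using word_writhe_real_part[OF cw'] word_writhe_knot(2)[OF assms(1) that(1) assms(2)] by simp
  qed
  have "closed_surface (word_surface True (real_part D))"
      "closed_diagram_on (word_surface True (real_part D)) (word_walk (real_part D)) (real_part D)"
    using closed_surface_word_surface[OF cw] closed_diagram_on_word_surface[OF cw] by simp_all
  then show "\<exists>D'\<in>K. \<exists>S ds. closed_surface S \<and> closed_diagram_on S ds (real_part D') \<and>
      word_writhe a D = writhe_sum a S ds (real_part D')"
    using assms(2) sum by metis
  show "f = word_writhe a D" if "\<exists>D\<in>K. \<exists>S ds. closed_surface S \<and> closed_diagram_on S ds (real_part D) \<and>
      f = writhe_sum a S ds (real_part D)" for f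
    using that sum by auto
qed

lemma ex_knot_of_planar:
  assumes "planar w" "closable w" "planar (real_part w)"
  shows "\<exists>K\<in>long_virtual_knots. writhe_poly a K = word_writhe a w \<and> sg2 K = 0"
proof -
  let ?K = "diagram_equiv `` {w}"
  note cw = planar_crossing_word[OF assms(1)] and cwr = planar_crossing_word[OF assms(3)]
  have lvd: "long_virtual_diagram w"
    unfolding long_virtual_diagram_def
    using cw surface_of_genus_0_word_surface[OF cw assms(1), of True] assms(2)
      closed_diagram_on_word_surface[OF cw, of True] by blast
  have K: "?K \<in> long_virtual_knots"
    unfolding long_virtual_knots_def using lvd by (intro quotientI) simp
  have w: "w \<in> ?K" using lvd by (rule self_in_knot)
  have "two_realization 0 (word_surface False (real_part w)) (word_walk (real_part w)) w"
    unfolding two_realization_def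
    using surface_of_genus_0_word_surface[OF cwr assms(3), of False] diagram_on_word_surface[OF cwr, of False]
      start_neq_end_word_surface[OF cwr, of False] by simp
  then have "\<exists>D\<in>?K. \<exists>S ds. two_realization 0 S ds D" using w by blast
  then have "sg2 ?K = 0" unfolding sg2_def by (rule Least_eq_0)
  then show ?thesis using K writhe_poly_eq_word_writhe[OF K w] by blast
qed

section \<open>Laurent polynomials vanishing at 1\<close>

text \<open>The value at 1, kept in the integers.\<close>

definition coeff_sum :: "laurent \<Rightarrow> int" where
  "coeff_sum f = (\<Sum>k\<in>Poly_Mapping.keys f. Poly_Mapping.lookup f k)"

lemma coeff_sum_superset: "finite A \<Longrightarrow> Poly_Mapping.keys f \<subseteq> A \<Longrightarrow> coeff_sum f = (\<Sum>k\<in>A. Poly_Mapping.lookup f k)"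
  unfolding coeff_sum_def by (rule sum.mono_neutral_left) (auto simp: in_keys_iff)

lemma coeff_sum_add: "coeff_sum (f + g) = coeff_sum f + coeff_sum g"
  using coeff_sum_superset[of "Poly_Mapping.keys f \<union> Poly_Mapping.keys g" "f + g"]
    coeff_sum_superset[of "Poly_Mapping.keys f \<union> Poly_Mapping.keys g" f]
    coeff_sum_superset[of "Poly_Mapping.keys f \<union> Poly_Mapping.keys g" g]
  by (simp add: Poly_Mapping.keys_add lookup_add sum.distrib)

lemma coeff_sum_uminus: "coeff_sum (- f) = - coeff_sum f"
  using coeff_sum_add[of f "- f"] by (simp add: coeff_sum_def)

lemma coeff_sum_sum: "coeff_sum (\<Sum>x\<in>A. F x) = (\<Sum>x\<in>A. coeff_sum (F x))"
  by (induction A rule: infinite_finite_induct) (auto simp: coeff_sum_add, simp_all add: coeff_sum_def)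

lemma coeff_sum_single [simp]: "coeff_sum (Poly_Mapping.single k c) = c"
  by (simp add: coeff_sum_def)

lemma laurent_eval_1: "laurent_eval f (1 :: rat) = of_int (coeff_sum f)"
  by (simp add: laurent_eval_def coeff_sum_def)

lemma coeff_sum_crossing_term: "coeff_sum (crossing_term w x) = 0"
proof -
  let ?g = "Poly_Mapping.single (idx w x) (1 :: int) - 1"
  have "coeff_sum ?g = 0"
    using coeff_sum_add[of ?g 1] coeff_sum_single[of 0 1] by simp
  then have "coeff_sum ?g = 0" "coeff_sum (- ?g) = 0" by (simp_all only: coeff_sum_uminus minus_zero)
  then show ?thesis unfolding crossing_term_def by (cases "flag x") (simp_all only: if_True if_False mult_1_left mult_minus1)
qed

lemma coeff_sum_word_writhe: "coeff_sum (word_writhe a w) = 0"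
  by (simp add: word_writhe_def coeff_sum_sum coeff_sum_crossing_term)

lemma laurent_eq_sum_single: "(f :: laurent) = (\<Sum>k\<in>Poly_Mapping.keys f. Poly_Mapping.single k (Poly_Mapping.lookup f k))"
  by (rule poly_mapping_eqI) (auto simp: lookup_sum lookup_single when_def in_keys_iff)

section \<open>Writhe sums of spirals\<close>

text \<open>All passages between those of a crossing belong to the same factor, so the indices do
  not see the other factor.\<close>

lemma word_writhe_append:
  assumes "crossing_word u" "crossing_word z" "crossing_word (u @ z)"
  shows "word_writhe a (u @ z) = word_writhe a u + word_writhe a z"
proof -
  have d: "set u \<inter> set z = {}" using crossing_word_distinct[OF assms(3)] by simp
  have pu: "partner x \<in> set u" if "x \<in> set u" for x using assms(1) that by (rule crossing_word_partner)
  have pz: "partner x \<in> set z" "partner x \<notin> set u" "x \<notin> set u" if "x \<in> set z" for x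
    using crossing_word_partner[OF assms(2) that] that d by auto
  have iu: "crossing_term (u @ z) x = crossing_term u x" if "x \<in> set u" for x
    using that pu by (simp add: crossing_term_def idx_def hgt_append)
  have iz: "crossing_term (u @ z) x = crossing_term z x" if "x \<in> set z" for x
    using pz[OF that] by (simp add: crossing_term_def idx_def hgt_append)
  have "firsts a (u @ z) = firsts a u \<union> firsts a z"
    using pu pz by (auto simp: firsts_def pos_append)
  moreover have "firsts a u \<inter> firsts a z = {}" using d by (auto simp: firsts_def)
  ultimately have "word_writhe a (u @ z) = (\<Sum>x\<in>firsts a u. crossing_term (u @ z) x) + (\<Sum>x\<in>firsts a z. crossing_term (u @ z) x)"
    by (simp add: word_writhe_def sum.union_disjoint)
  also have "\<dots> = word_writhe a u + word_writhe a z"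
    unfolding word_writhe_def by (intro arg_cong2[where f = plus] sum.cong refl iu iz) (auto simp: firsts_def)
  finally show ?thesis .
qed

lemma hgt_mirror: "hgt (map mirror w) (mirror x) = - hgt w x"
proof -
  have "rho (mirror y) = - rho y" for y by (simp add: rho_def)
  then show ?thesis by (induction w) auto
qed

lemma firsts_mirror: "firsts a (map mirror w) = mirror ` firsts a w"
proof -
  have m: "x \<in> mirror ` A \<longleftrightarrow> mirror x \<in> A" for x A
    by (metis imageE imageI mirror_mirror)
  have p: "pos (map mirror w) x = pos w (mirror x)" "pos (map mirror w) (partner x) = pos w (mirror (partner x))" for x
    using pos_mirror[of w "mirror x"] pos_mirror[of w "mirror (partner x)"] by simp_all
  show ?thesis
  proof (rule set_eqI)
    fix x
    show "x \<in> firsts a (map mirror w) \<longleftrightarrow> x \<in> mirror ` firsts a w"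
      unfolding m by (simp add: firsts_def p m)
  qed
qed

lemma flag_mirror: "flag (mirror x) \<longleftrightarrow> \<not> flag x"
  by (cases x) auto

lemma idx_mirror: "idx (map mirror w) (mirror x) = - idx w x"
  by (simp add: idx_def hgt_mirror rho_def)

lemma idx_split:
  assumes "distinct (a @ x # b @ partner x # c)"
  shows "idx (a @ x # b @ partner x # c) x = sum_list (map rho b)"
  using assms by (auto simp: idx_def hgt_append)

text \<open>Prescribes the side from which the other strand comes; this forces the sign, which is
  opposite for over and under passages.\<close>

definition real_passage :: "bool \<Rightarrow> nat \<Rightarrow> bool \<Rightarrow> passage" where
  "real_passage over l r = (if over then Over l r else Under l (\<not> r))"

lemma real_passage_simps [simp]:
  "label (real_passage over l r) = l" "rtl (real_passage over l r) \<longleftrightarrow> r"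
  "is_over (real_passage over l r) \<longleftrightarrow> over" "\<not> is_virt (real_passage over l r)"
  "flag (real_passage over l r) \<longleftrightarrow> (over \<longleftrightarrow> r)"
  by (auto simp: real_passage_def)

context spiral
begin

lemma real_part_closed_spiral:
  assumes "\<And>i. \<not> is_virt (q i)" "\<And>i. \<not> is_virt (out i)" "\<And>i. is_virt (v i)"
  shows "real_part (closed_spiral m) = arc_spiral m"
proof -
  have "real_part (crossed_turns 0 m) = turns_upto m"
    using assms by (induction m) (simp_all add: crossed_turns_def turns_upto_def real_part_def)
  moreover have "real_part (down v 0 m) = []" using assms by (simp add: real_part_def filter_empty_conv)
  moreover have "real_part (strands m) = strands m" using assms by (auto simp: real_part_def strands_def filter_id_conv)
  ultimately show ?thesis by (simp add: closed_spiral_def arc_spiral_def real_part_append)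
qed

text \<open>A full turn crosses the two antiparallel strands with opposite signs, while the outward
  strand collects 1 from each turn.\<close>

lemma rho_spiral:
  assumes "\<And>i. \<not> is_virt (q i)" "\<And>i. \<not> is_virt (out i)"
  shows "sum_list (map rho (turns_upto m)) = 0" "sum_list (map rho (down out 0 m)) = int m"
    and "rho (partner (q m)) = 1"
proof -
  have r: "rho (q i) = - 1" "rho (out i) = 1" for i
    using assms rtl_q rtl_out by (simp_all add: rho_def)
  show "sum_list (map rho (turns_upto m)) = 0" by (induction m) (simp_all add: turns_upto_Suc r)
  show "sum_list (map rho (down out 0 m)) = int m" by (induction m) (simp_all add: down_Suc r)
  show "rho (partner (q m)) = 1" by (simp add: r)
qed

text \<open>Between the passages of \<open>q k\<close> lie \<open>k + 1\<close> passages of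
  \<open>out\<close>; between those of \<open>out k\<close> only \<open>k\<close>, but
  \<open>partner (q k)\<close> replaces the missing one. Complete turns add 0.\<close>

lemma idx_arc_spiral:
  assumes "\<And>i. \<not> is_virt (q i)" "\<And>i. \<not> is_virt (out i)" and d: "distinct (arc_spiral (Suc k))"
  shows "idx (arc_spiral (Suc k)) (q k) = int (Suc k)" "idx (arc_spiral (Suc k)) (out k) = int (Suc k)"
proof -
  have 1: "arc_spiral (Suc k) = map q [0..<k] @ q k # (down out 0 (Suc k) @ turns_upto k) @ partner (q k) # [partner (out k)]"
    by (simp add: arc_spiral_def strands_def turns_upto_Suc)
  have 2: "arc_spiral (Suc k) = map q [0..<Suc k] @ out k # (down out 0 k @ turns_upto k @ [partner (q k)]) @ partner (out k) # []"
    by (simp add: arc_spiral_def strands_def turns_upto_Suc down_Suc)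
  show "idx (arc_spiral (Suc k)) (q k) = int (Suc k)"
    using idx_split[OF d[unfolded 1]] rho_spiral[OF assms(1,2)] by (simp add: 1)
  show "idx (arc_spiral (Suc k)) (out k) = int (Suc k)"
    using idx_split[OF d[unfolded 2]] rho_spiral[OF assms(1,2)] by (simp add: 2)
qed

lemma firsts_arc_spiral:
  assumes "\<And>i. \<not> is_virt (q i)" "\<And>i. \<not> is_virt (out i)" and d: "distinct (arc_spiral m)"
  shows "firsts a (arc_spiral m) = {x \<in> q ` {0..<m} \<union> out ` {0..<m}. a = (if is_over x then 0 else 1)}"
proof -
  have set: "set (strands m) = q ` {0..<m} \<union> out ` {0..<m}" by (auto simp: strands_def)
  have part: "partner x \<in> set (turns_upto m)" "partner x \<notin> set (strands m)" if "x \<in> set (strands m)" for x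
  proof -
    show "partner x \<in> set (turns_upto m)" using that by (auto simp: set set_turns_upto)
    then show "partner x \<notin> set (strands m)" using d by (auto simp: arc_spiral_def)
  qed
  have first: "pos (arc_spiral m) x < pos (arc_spiral m) (partner x)" if "x \<in> set (strands m)" for x
    using part[OF that] pos_less[OF that] that by (simp add: arc_spiral_def pos_append)
  have "x \<in> set (strands m)"
    if "x \<in> set (arc_spiral m)" "pos (arc_spiral m) x < pos (arc_spiral m) (partner x)" for x
  proof (rule ccontr)
    assume "x \<notin> set (strands m)"
    then have "x \<in> set (turns_upto m)" using that by (simp add: arc_spiral_def)
    then have "partner x \<in> set (strands m)" by (auto simp: set set_turns_upto)
    then show False using first[of "partner x"] that(2) by simp
  qed
  then show ?thesis
    unfolding firsts_def using first assms(1,2) set by (auto simp: arc_spiral_def)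
qed

end

section \<open>Realizing all polynomials\<close>

definition realizable :: "nat \<Rightarrow> laurent \<Rightarrow> bool" where
  "realizable a f \<longleftrightarrow> (\<exists>w. planar w \<and> closable w \<and> planar (real_part w) \<and> word_writhe a w = f)"

lemma real_part_mirror: "real_part (map mirror w) = map mirror (real_part w)"
  by (simp add: real_part_def filter_map comp_def)

text \<open>Of all crossings of the spiral only the innermost one on one of the two strands gets type
  \<open>a\<close>; its index is the number of turns, and the choice of the strand determines its sign.  Negative
  indices come from the mirror image.\<close>

lemma realizable_add_generator:
  assumes "realizable a f" and a: "a = (if b then 0 else 1)" and "k \<noteq> 0"
  shows "realizable a (f + (if s then 1 else - 1) * (Poly_Mapping.single k 1 - 1))"
proof -
  obtain w where w: "planar w" "closable w" "planar (real_part w)" "word_writhe a w = f"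
    using assms(1) by (auto simp: realizable_def)
  define L where "L = Suc (Max (insert 0 (label ` set w)))"
  have fresh: "label y < L" if "y \<in> set w" for y
    using that by (simp add: L_def less_Suc_eq_le)
  define neg where "neg = (k < 0)"
  \<comment> \<open>Turns are numbered from 0, so \<open>h\<close> is the innermost of
    \<open>\<bar>k\<bar>\<close> turns.\<close>
  define h where "h = nat \<bar>k\<bar> - 1"
  have h: "int (Suc h) = \<bar>k\<bar>" using assms(3) by (simp add: h_def)
  define mir where "mir = (if neg then map mirror else id)"
  \<comment> \<open>A crossing of type \<open>a\<close> has flag \<open>b\<close> on the outward
    strand and the opposite flag on the inward one; reflection inverts it once more. This choice
    yields the sign \<open>s\<close>.\<close>
  define strand where "strand = ((s \<noteq> neg) = b)"
  define q where "q i = real_passage ((i = h \<and> \<not> strand) = b) (L + 3 * i) False" for i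
  define out where "out i = real_passage ((i = h \<and> strand) = b) (L + 3 * i + 1) True" for i
  define v where "v i = Virt (L + 3 * i + 2) True" for i
  interpret spiral q out v L
    by unfold_locales (simp_all add: q_def out_def v_def)
  have real: "\<not> is_virt (q i)" "\<not> is_virt (out i)" "is_virt (v i)" for i
    by (simp_all add: q_def out_def v_def)
  define B where "B = closed_spiral (Suc h)"
  let ?w = "w @ mir B"
  have pm: "planar (mir z)" if "planar z" for z
    using that by (simp add: mir_def planar_mirror)
  have cm: "closable (mir z)" if "planar z" "closable z" for z
    using that by (simp add: mir_def closable_mirror planar_crossing_word)
  have fr: "\<forall>y\<in>set (mir w). label y < L" "\<forall>y\<in>set (mir (real_part w)). label y < L"
    using fresh by (auto simp: mir_def set_real_part)
  \<comment> \<open>Spirals of only one handedness are available. For the other, the spiral is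
    appended to the mirror image of \<open>w\<close> and everything is reflected back, which
    restores \<open>w\<close>.\<close>
  have app: "mir (mir x @ y) = x @ mir y" for x y by (auto simp: mir_def comp_def)
  have pB: "planar (mir w @ B)"
    unfolding B_def using pm[OF w(1)] fr(1) by (rule planar_closed_spiral)
  have cB: "closable (mir w @ B)"
    unfolding B_def using pm[OF w(1)] fr(1) cm[OF w(1,2)] by (rule closable_closed_spiral)
  have p1: "planar ?w" using pm[OF pB] by (simp only: app)
  have p2: "closable ?w" using cm[OF pB cB] by (simp only: app)
  have "planar (mir (mir (real_part w) @ arc_spiral (Suc h)))"
    using pm[OF w(3)] fr(2) by (rule pm[OF planar_arc_spiral])
  moreover have "real_part ?w = real_part w @ mir (arc_spiral (Suc h))"
    using real_part_closed_spiral[OF real, of "Suc h"]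
    by (auto simp: real_part_append mir_def real_part_mirror B_def)
  ultimately have p3: "planar (real_part ?w)" by (simp only: app)
  have cB: "crossing_word B"
    using planar_crossing_word[OF planar_closed_spiral[OF planar_Nil, of "Suc h"]] by (simp add: B_def)
  let ?A = "arc_spiral (Suc h)" and ?x = "if strand then out h else q h"
  have rB: "real_part B = ?A" using real_part_closed_spiral[OF real] by (simp add: B_def)
  have cA: "crossing_word ?A" using crossing_word_real_part[OF cB] by (simp add: rB)
  have sel: "a = (if is_over (q i) then 0 else 1) \<longleftrightarrow> i = h \<and> \<not> strand"
      "a = (if is_over (out i) then 0 else 1) \<longleftrightarrow> i = h \<and> strand" for i
    using a by (auto simp: q_def out_def)
  have x: "firsts a ?A = {?x}"
    unfolding firsts_arc_spiral[OF real(1,2) crossing_word_distinct[OF cA]]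
  proof (intro equalityI subsetI)
    fix y assume "y \<in> {y \<in> q ` {0..<Suc h} \<union> out ` {0..<Suc h}. a = (if is_over y then 0 else 1)}"
    then consider i where "y = q i" "a = (if is_over (q i) then 0 else 1)"
      | i where "y = out i" "a = (if is_over (out i) then 0 else 1)" by blast
    then show "y \<in> {?x}" by cases (simp_all only: sel, simp_all)
  next
    fix y assume "y \<in> {?x}"
    then show "y \<in> {y \<in> q ` {0..<Suc h} \<union> out ` {0..<Suc h}. a = (if is_over y then 0 else 1)}"
      using sel[of h] by (cases strand) simp_all
  qed
  have ix: "idx ?A ?x = \<bar>k\<bar>"
    using idx_arc_spiral[OF real(1,2) crossing_word_distinct[OF cA]] unfolding h
    by (cases strand) (simp_all only: if_True if_False)
  have fx: "flag ?x \<longleftrightarrow> (s \<noteq> neg)"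
    by (auto simp: q_def out_def strand_def)
  have "word_writhe a (mir ?A) = (if s then 1 else - 1) * (Poly_Mapping.single k 1 - 1)"
  proof (cases neg)
    case True
    have "word_writhe a (mir ?A) = crossing_term (map mirror ?A) (mirror ?x)"
      using True by (simp add: mir_def word_writhe_def firsts_mirror x)
    also have "\<dots> = (if s then 1 else - 1) * (Poly_Mapping.single k 1 - 1)"
      using True fx unfolding crossing_term_def idx_mirror ix flag_mirror by (simp add: neg_def)
    finally show ?thesis .
  next
    case False
    have "word_writhe a (mir ?A) = crossing_term ?A ?x"
      using False by (simp add: mir_def word_writhe_def x)
    also have "\<dots> = (if s then 1 else - 1) * (Poly_Mapping.single k 1 - 1)"
      using False fx unfolding crossing_term_def ix by (simp add: neg_def)
    finally show ?thesis .
  qed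
  moreover have cM: "crossing_word (mir B)" using cB crossing_word_mirror by (auto simp: mir_def)
  have "word_writhe a (mir B) = word_writhe a (mir ?A)"
    using word_writhe_real_part[OF cM] rB by (auto simp: mir_def real_part_mirror)
  moreover have "word_writhe a ?w = word_writhe a w + word_writhe a (mir B)"
    using planar_crossing_word[OF w(1)] cM planar_crossing_word[OF p1] by (rule word_writhe_append)
  ultimately have "word_writhe a ?w = f + (if s then 1 else - 1) * (Poly_Mapping.single k 1 - 1)"
    using w(4) by simp
  then show ?thesis using p1 p2 p3 unfolding realizable_def by blast
qed

lemma realizable_add_multiple:
  assumes "realizable a f" and "a = (if b then 0 else 1)"
  shows "realizable a (f + (Poly_Mapping.single k n - Poly_Mapping.single 0 n))"
proof (cases "k = 0")
  case False
  have one: "Poly_Mapping.single k (n + i) - Poly_Mapping.single 0 (n + i) =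
      (Poly_Mapping.single k n - Poly_Mapping.single 0 n) + (Poly_Mapping.single k i - Poly_Mapping.single 0 i)" for n i :: int
    by (simp add: single_add)
  have gen: "realizable a (g + (Poly_Mapping.single k 1 - Poly_Mapping.single 0 1))"
      "realizable a (g + (Poly_Mapping.single k (- 1) - Poly_Mapping.single 0 (- 1)))" if "realizable a g" for g
    using realizable_add_generator[OF that assms(2) False, of True]
      realizable_add_generator[OF that assms(2) False, of False]
    by (simp_all add: single_uminus algebra_simps)
  show ?thesis
  proof (induction n rule: int_induct[of _ 0])
    case base
    then show ?case using assms(1) by simp
  next
    case (step1 i)
    then show ?case using gen(1)[OF step1(2)] by (simp only: one add.assoc)
  next
    case (step2 i)
    then show ?case using gen(2)[OF step2(2)] one[of i "- 1"] by (simp add: add.assoc)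
  qed
qed (use assms(1) in simp)

text \<open>As the coefficients add up to 0, 1 can be subtracted from every monomial without
  changing \<open>f\<close>, which exhibits it as a combination of the generators.\<close>

lemma realizable_if_coeff_sum_zero:
  assumes "coeff_sum f = 0" and a: "a = (if b then 0 else 1)"
  shows "realizable a f"
proof -
  have "realizable a (\<Sum>k\<in>A. Poly_Mapping.single k (Poly_Mapping.lookup f k) - Poly_Mapping.single 0 (Poly_Mapping.lookup f k))"
    if "finite A" for A
    using that
  proof induction
    case empty
    have "word_writhe a [] = 0" by (simp add: word_writhe_def firsts_def)
    then show ?case
      using planar_Nil closable_Nil unfolding realizable_def
      by (intro exI[of _ "[]"]) (simp add: real_part_def)
  next
    case (insert k A)
    then show ?case using realizable_add_multiple[OF insert.IH a] by (simp add: add.commute)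
  qed
  from this[of "Poly_Mapping.keys f"]
  have "realizable a ((\<Sum>k\<in>Poly_Mapping.keys f. Poly_Mapping.single k (Poly_Mapping.lookup f k)) -
      (\<Sum>k\<in>Poly_Mapping.keys f. Poly_Mapping.single 0 (Poly_Mapping.lookup f k)))"
    by (simp add: sum_subtractf)
  moreover have "(\<Sum>k\<in>A. Poly_Mapping.single 0 (Poly_Mapping.lookup f k)) = Poly_Mapping.single 0 (\<Sum>k\<in>A. Poly_Mapping.lookup f k)" for A
    by (induction A rule: infinite_finite_induct) (simp_all add: single_add)
  from this[of "Poly_Mapping.keys f"]
  have "(\<Sum>k\<in>Poly_Mapping.keys f. Poly_Mapping.single 0 (Poly_Mapping.lookup f k)) = (0 :: laurent)"
    using assms(1) unfolding coeff_sum_def by (simp only: single_zero)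
  ultimately show ?thesis
    by (simp only: laurent_eq_sum_single[of f, symmetric] diff_zero)
qed

lemma ex_knot_iff:
  assumes "a = (if b then 0 else 1)"
  shows "(\<exists>K\<in>long_virtual_knots. writhe_poly a K = f \<and> sg2 K = 0) \<longleftrightarrow> laurent_eval f (1 :: rat) = 0"
proof
  assume "\<exists>K\<in>long_virtual_knots. writhe_poly a K = f \<and> sg2 K = 0"
  then obtain K where K: "K \<in> long_virtual_knots" "writhe_poly a K = f" by blast
  then obtain D where "D \<in> K"
    using self_in_knot by (auto simp: long_virtual_knots_def elim!: quotientE)
  then have "f = word_writhe a D" using writhe_poly_eq_word_writhe[OF K(1)] K(2) by simp
  then show "laurent_eval f (1 :: rat) = 0" by (simp add: laurent_eval_1 coeff_sum_word_writhe)
next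
  assume "laurent_eval f (1 :: rat) = 0"
  then have "realizable a f" using assms by (intro realizable_if_coeff_sum_zero) (simp_all add: laurent_eval_1)
  then show "\<exists>K\<in>long_virtual_knots. writhe_poly a K = f \<and> sg2 K = 0"
    using ex_knot_of_planar unfolding realizable_def by metis
qed

theorem proposition6p2:
  fixes f :: laurent
  shows "((\<exists>K\<in>long_virtual_knots. writhe_poly 0 K = f \<and> sg2 K = 0) \<longleftrightarrow> laurent_eval f (1::rat) = 0) \<and>
         ((\<exists>K\<in>long_virtual_knots. writhe_poly 1 K = f \<and> sg2 K = 0) \<longleftrightarrow> laurent_eval f (1::rat) = 0)"
  using ex_knot_iff[of 0 True f] ex_knot_iff[of 1 False f] by simp

end
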